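(* Let $G$ be a torsion-free group, let $(\{\alpha_g\}_{g\in G},\{D_g\}_{g\in G})$ be a partial action of $G$ on a nonzero $s$-unital ring $R$, and let $R\star_\alpha G$ be the associated $s$-unital partial skew group ring. Then $R\star_\alpha G$ is prime if and only if $R$ is $G$-prime.
   Context: Rings are associative but not necessarily unital; ideals are two-sided. For subsets $U,V$ of a ring, $UV$ denotes the set of finite sums of elements $uv$ with $u\in U$, $v\in V$. A ring $R$ is $s$-unital if $r\in rR\cap Rr$ for every $r\in R$. A ring $T$ is prime if $\{0\}$ is a proper ideal and for all ideals $A,B$ of $T$, $AB=\{0\}$ implies $A=\{0\}$ or $B=\{0\}$. A partial action of a group $G$ (neutral element $e$) on an $s$-unital ring $R$ is a pair $(\{\alpha_g\}_{g\in G},\{D_g\}_{g\in G})$ where for each $g\in G$, $D_g$ is a (possibly zero) $s$-unital ideal of $R$ and $\alpha_g:D_{g^{-1}}\to D_g$ is a ring isomorphism, such that for all $g,h\in G$: (P1) $\alpha_e=\mathrm{id}_R$ (so $D_e=R$); (P2) $\alpha_g(D_{g^{-1}}D_h)=D_gD_{gh}$; (P3) if $r\in D_{h^{-1}}D_{(gh)^{-1}}$, then $\alpha_g(\alpha_h(r))=\alpha_{gh}(r)$. The $s$-unital partial skew group ring is $R\star_\alpha G:=\bigoplus_{g\in G}D_g\delta_g$, where the $\delta_g$ are formal symbols, with multiplication determined by $(r\delta_g)(r'\delta_h)=\alpha_g(\alpha_{g^{-1}}(r)r')\delta_{gh}$ for $r\in D_g$, $r'\in D_h$; it is an associative ring.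 An ideal $I$ of $R$ is $G$-invariant if $\alpha_g(ID_{g^{-1}})\subseteq I$ for every $g\in G$. $R$ is $G$-prime if for all $G$-invariant ideals $I,J$ of $R$, $IJ=\{0\}$ implies $I=\{0\}$ or $J=\{0\}$. *)

theory Defs
  imports "HOL-Library.Poly_Mapping"
begin

text \<open>
  Non-unital associative rings are given by a subset \<open>T\<close> of an abelian group together with a
  multiplication \<open>mult\<close>; the addition is that of the ambient type. The ring \<open>R\<close> of the main
  statement is a whole type of class \<^class>\<open>ring\<close> (which has no unit), i.e. \<open>T = UNIV\<close> and
  \<open>mult = (*)\<close>; the set-based form is needed for ideals regarded as rings and for the partial
  skew group ring.
\<close>

definition finite_sums_of_products ::
    "('a \<Rightarrow> 'a \<Rightarrow> 'a) \<Rightarrow> 'a set \<Rightarrow> 'a set \<Rightarrow> 'a::ab_group_add set" where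
  "finite_sums_of_products mult U V =
    {\<Sum>i<n. mult (u i) (v i) | (n::nat) u v. (\<forall>i<n. u i \<in> U \<and> v i \<in> V)}"

definition is_ideal :: "'a set \<Rightarrow> ('a \<Rightarrow> 'a \<Rightarrow> 'a) \<Rightarrow> 'a::ab_group_add set \<Rightarrow> bool" where
  "is_ideal T mult I \<longleftrightarrow>
    I \<subseteq> T \<and> 0 \<in> I \<and> (\<forall>x\<in>I. \<forall>y\<in>I. x + y \<in> I) \<and> (\<forall>x\<in>I. - x \<in> I) \<and>
    (\<forall>t\<in>T. \<forall>x\<in>I. mult t x \<in> I \<and> mult x t \<in> I)"

definition s_unital_ring :: "'a set \<Rightarrow> ('a \<Rightarrow> 'a \<Rightarrow> 'a::ab_group_add) \<Rightarrow> bool" where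
  "s_unital_ring T mult \<longleftrightarrow>
    (\<forall>r\<in>T. r \<in> finite_sums_of_products mult {r} T \<inter> finite_sums_of_products mult T {r})"

definition prime_ring :: "'a set \<Rightarrow> ('a \<Rightarrow> 'a \<Rightarrow> 'a::ab_group_add) \<Rightarrow> bool" where
  "prime_ring T mult \<longleftrightarrow>
    {0} \<noteq> T \<and>
    (\<forall>A B. is_ideal T mult A \<longrightarrow> is_ideal T mult B \<longrightarrow>
      finite_sums_of_products mult A B = {0} \<longrightarrow> A = {0} \<or> B = {0})"

definition ring_iso_on :: "'a set \<Rightarrow> 'a set \<Rightarrow> ('a::ring \<Rightarrow> 'a) \<Rightarrow> bool" where
  "ring_iso_on S S' f \<longleftrightarrow>
    bij_betw f S S' \<and> (\<forall>x\<in>S. \<forall>y\<in>S. f (x + y) = f x + f y \<and> f (x * y) = f x * f y)"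

abbreviation ring_ideal :: "'r::ring set \<Rightarrow> bool" where
  "ring_ideal I \<equiv> is_ideal UNIV (*) I"

abbreviation ideal_prod :: "'r::ring set \<Rightarrow> 'r set \<Rightarrow> 'r set" (infixl "\<odot>" 70) where
  "U \<odot> V \<equiv> finite_sums_of_products (*) U V"

text \<open>
  The group \<open>G\<close> is a type of class \<^class>\<open>group_add\<close>, which is the library's class of
  not necessarily commutative groups. It is written additively: \<open>0\<close> is the neutral element,
  \<open>- g\<close> the inverse of \<open>g\<close>, and \<open>g + h\<close> the group product \<open>gh\<close>.
  The value of \<open>\<alpha> g\<close> is only relevant on its domain \<open>D (- g)\<close>.
\<close>

locale partial_action =
  fixes D :: "'g::group_add \<Rightarrow> 'r::ring set"
    and \<alpha> :: "'g \<Rightarrow> 'r \<Rightarrow> 'r"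
  assumes s_unital_R: "s_unital_ring (UNIV :: 'r set) (*)"
    and ideal_D: "ring_ideal (D g)"
    and s_unital_D: "s_unital_ring (D g) (*)"
    and iso: "ring_iso_on (D (- g)) (D g) (\<alpha> g)"
    and P1: "D 0 = UNIV" "\<alpha> 0 r = r"
    and P2: "\<alpha> g ` (D (- g) \<odot> D h) = D g \<odot> D (g + h)"
    and P3: "r \<in> D (- h) \<odot> D (- (g + h)) \<Longrightarrow> \<alpha> g (\<alpha> h r) = \<alpha> (g + h) r"

definition G_invariant ::
    "('g::group_add \<Rightarrow> 'r::ring set) \<Rightarrow> ('g \<Rightarrow> 'r \<Rightarrow> 'r) \<Rightarrow> 'r set \<Rightarrow> bool" where
  "G_invariant D \<alpha> I \<longleftrightarrow> (\<forall>g. \<alpha> g ` (I \<odot> D (- g)) \<subseteq> I)"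

definition G_prime ::
    "('g::group_add \<Rightarrow> 'r::ring set) \<Rightarrow> ('g \<Rightarrow> 'r \<Rightarrow> 'r) \<Rightarrow> bool" where
  "G_prime D \<alpha> \<longleftrightarrow>
    (\<forall>I J. ring_ideal I \<longrightarrow> G_invariant D \<alpha> I \<longrightarrow> ring_ideal J \<longrightarrow> G_invariant D \<alpha> J \<longrightarrow>
      I \<odot> J = {0} \<longrightarrow> I = {0} \<or> J = {0})"

text \<open>
  The formal sum of the \<open>r\<^sub>g \<delta>\<^sub>g\<close> is the finitely supported function \<open>g \<mapsto> r\<^sub>g\<close>;
  in particular \<open>r \<delta>\<^sub>g\<close> is \<open>Poly_Mapping.single g r\<close>. The addition is that of
  \<^type>\<open>poly_mapping\<close>, but the library's convolution product on that type is not used: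
  \<open>skew_mult\<close> is the biadditive extension of
  \<open>(r \<delta>\<^sub>g) (r' \<delta>\<^sub>h) = (\<alpha> g (\<alpha> (- g) r * r')) \<delta>\<^bsub>g + h\<^esub>\<close>.
\<close>

definition skew_carrier :: "('g \<Rightarrow> 'r::zero set) \<Rightarrow> ('g \<Rightarrow>\<^sub>0 'r) set" where
  "skew_carrier D = {x. \<forall>g. Poly_Mapping.lookup x g \<in> D g}"

definition skew_mult ::
    "('g::group_add \<Rightarrow> 'r::ring \<Rightarrow> 'r) \<Rightarrow> ('g \<Rightarrow>\<^sub>0 'r) \<Rightarrow> ('g \<Rightarrow>\<^sub>0 'r) \<Rightarrow> ('g \<Rightarrow>\<^sub>0 'r)" where
  "skew_mult \<alpha> x y =
    (\<Sum>g\<in>Poly_Mapping.keys x. \<Sum>h\<in>Poly_Mapping.keys y.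
      Poly_Mapping.single (g + h)
        (\<alpha> g (\<alpha> (- g) (Poly_Mapping.lookup x g) * Poly_Mapping.lookup y h)))"

context partial_action
begin

lemma zero_D: "0 \<in> D g"
  using ideal_D[of g] by (simp add: is_ideal_def)

lemma alpha_zero: "\<alpha> g 0 = 0"
proof -
  have "\<alpha> g (0 + 0) = \<alpha> g 0 + \<alpha> g 0"
    using iso[of g] zero_D[of "- g"] unfolding ring_iso_on_def by blast
  then show ?thesis by simp
qed

lemma skew_mult_single:
  "skew_mult \<alpha> (Poly_Mapping.single g r) (Poly_Mapping.single h r') =
    Poly_Mapping.single (g + h) (\<alpha> g (\<alpha> (- g) r * r'))"
  by (cases "r = 0"; cases "r' = 0") (simp_all add: skew_mult_def alpha_zero)

lemma skew_mult_closed: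
  assumes x: "x \<in> skew_carrier D" and y: "y \<in> skew_carrier D"
  shows "skew_mult \<alpha> x y \<in> skew_carrier D"
proof -
  have key: "\<alpha> g (\<alpha> (- g) r * r') \<in> D (g + h)" if r: "r \<in> D g" and r': "r' \<in> D h" for g h r r'
  proof -
    have a: "\<alpha> (- g) r \<in> D (- g)"
      using iso[of "- g"] r by (auto simp: ring_iso_on_def bij_betw_def)
    have "\<alpha> (- g) r * r' \<in> D (- g) \<odot> D h"
      unfolding finite_sums_of_products_def using a r'
      by (intro CollectI exI[of _ "1::nat"] exI[of _ "\<lambda>_. \<alpha> (- g) r"] exI[of _ "\<lambda>_. r'"]) simp
    then have "\<alpha> g (\<alpha> (- g) r * r') \<in> D g \<odot> D (g + h)"
      using P2[of g h] by blast
    then obtain n :: nat and u v where s: "\<alpha> g (\<alpha> (- g) r * r') = (\<Sum>i<n. u i * v i)"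
      and v: "\<forall>i<n. v i \<in> D (g + h)"
      unfolding finite_sums_of_products_def by blast
    have "(\<Sum>i<m. u i * v i) \<in> D (g + h)" if "m \<le> n" for m
      using that
    proof (induction m)
      case 0
      then show ?case by (simp add: zero_D)
    next
      case (Suc m)
      then show ?case using v ideal_D[of "g + h"] by (simp add: is_ideal_def)
    qed
    then show ?thesis using s by simp
  qed
  have single: "Poly_Mapping.single g r \<in> skew_carrier D" if "r \<in> D g" for g r
    using that zero_D by (auto simp: skew_carrier_def lookup_single when_def)
  have sum: "sum f S \<in> skew_carrier D" if "\<And>s. s \<in> S \<Longrightarrow> f s \<in> skew_carrier D"
    for f :: "'g \<Rightarrow> 'g \<Rightarrow>\<^sub>0 'r" and S
    using that
  proof (induction S rule: infinite_finite_induct)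
    case (insert s S)
    then show ?case
      using ideal_D by (auto simp: skew_carrier_def lookup_add is_ideal_def)
  qed (simp_all add: skew_carrier_def zero_D)
  show ?thesis
    unfolding skew_mult_def
    by (intro sum single key) (use x y in \<open>auto simp: skew_carrier_def\<close>)
qed

end

end

theory Submission
  imports Defs "HOL-Algebra.FiniteProduct"
begin

text \<open>
  Suppose that \<open>R\<close> is \<open>G\<close>-prime and that \<open>A\<close>, \<open>B\<close> are nonzero ideals of the skew group ring with
  \<open>A B = 0\<close>; we follow Passman's \<open>\<Delta>\<close>-method. Take elements of minimal support in \<open>A\<close> and \<open>B\<close>; after
  shifting and conjugating, their supports \<open>F\<close>, \<open>E\<close> contain the neutral element and they share a
  nonzero coefficient \<open>k\<close> there. Minimality shows that whenever \<open>k (D\<^sub>x \<delta>\<^sub>x) k \<noteq> 0\<close>, no product in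
  \<open>F x E\<close> is unique. Such \<open>x\<close> exist by \<open>G\<close>-primeness; let \<open>W\<close> be a subgroup containing them, so that
  \<open>F, E \<subseteq> W\<close>. The elements of \<open>W\<close> with finite \<open>W\<close>-class form a torsion-free FC group, which is abelian
  and hence has unique products. So some \<open>x v x\<^sup>-\<^sup>1\<close> with \<open>v \<in> E E\<^sup>-\<^sup>1\<close> equals \<open>u = g'\<^sup>-\<^sup>1 g\<close>, where \<open>g, g' \<in> F\<close>,
  the \<open>W\<close>-class of \<open>g\<close> is finite and that of \<open>g'\<close> is infinite. Replacing \<open>k\<close> by a suitable nonzero
  multiple shrinks \<open>W\<close> to a subgroup for which the class of one such \<open>u\<close>, hence that of \<open>g'\<close>, becomes
  finite. Since \<open>F\<close> is finite, this cannot go on forever.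
\<close>

section \<open>Torsion-free groups\<close>

definition add_subgroup :: "'g::group_add set \<Rightarrow> bool" where
  "add_subgroup W \<longleftrightarrow> 0 \<in> W \<and> (\<forall>x\<in>W. \<forall>y\<in>W. x + y \<in> W) \<and> (\<forall>x\<in>W. - x \<in> W)"

definition torsion_free :: "'g::group_add itself \<Rightarrow> bool" where
  "torsion_free _ \<longleftrightarrow> (\<forall>(g::'g) n. n > 0 \<longrightarrow> sum_list (replicate n g) = 0 \<longrightarrow> g = 0)"

definition conjugate :: "'g::group_add \<Rightarrow> 'g \<Rightarrow> 'g" where
  "conjugate w g = w + g - w"

text \<open>Conjugation is by elements of \<open>W\<close> only, so shrinking \<open>W\<close> can
  make the class of an element finite; the final maximality argument rests on this.\<close>

definition fc_center :: "'g::group_add set \<Rightarrow> 'g set" where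
  "fc_center W = {g \<in> W. finite ((\<lambda>w. conjugate w g) ` W)}"

abbreviation (input) mul :: "nat \<Rightarrow> 'g::group_add \<Rightarrow> 'g" where
  "mul n g \<equiv> sum_list (replicate n g)"

section \<open>Conjugation, multiples and subgroups in additive notation\<close>

lemma torsion_freeD: "torsion_free TYPE('g::group_add) \<Longrightarrow> n > 0 \<Longrightarrow> mul n (g::'g) = 0 \<Longrightarrow> g = 0"
  by (auto simp: torsion_free_def)

lemma conjugate_add: "conjugate w (g + h) = conjugate w g + conjugate w h"
  by (simp add: conjugate_def diff_conv_add_uminus add.assoc del: add_uminus_conv_diff)

lemma conjugate_conjugate: "conjugate v (conjugate w g) = conjugate (v + w) g"
  by (simp add: conjugate_def diff_conv_add_uminus add.assoc minus_add del: add_uminus_conv_diff)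

lemma conjugate_0 [simp]: "conjugate 0 g = g" "conjugate w 0 = 0"
  by (simp_all add: conjugate_def)

lemma conjugate_minus: "conjugate w (- g) = - conjugate w g"
  by (simp add: conjugate_def diff_conv_add_uminus add.assoc minus_add del: add_uminus_conv_diff)

lemma conjugate_eq_self_iff: "conjugate w g = g \<longleftrightarrow> w + g = g + w"
  by (metis add_diff_cancel conjugate_def diff_add_cancel)

lemma conjugate_inverse [simp]: "conjugate (- w) (conjugate w g) = g" "conjugate w (conjugate (- w) g) = g"
  by (simp_all add: conjugate_conjugate)

lemma inj_conjugate: "inj (conjugate w)"
  by (metis conjugate_inverse(1) injI)

lemma mul_add: "mul (m + n) g = mul m g + mul n g"
  by (simp add: replicate_add)

lemma mul_mul: "mul m (mul n g) = mul (m * n) g"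
  by (induction m) (simp_all add: mul_add)

lemma mul_minus: "mul n (- g) = - mul n g"
proof (induction n)
  case (Suc n)
  have "mul (Suc n) g = mul n g + g"
    using mul_add[of n 1 g] by simp
  then show ?case using Suc by (simp add: minus_add)
qed simp

lemma mul_mem: "add_subgroup W \<Longrightarrow> g \<in> W \<Longrightarrow> mul n g \<in> W"
  by (induction n) (auto simp: add_subgroup_def)

lemma add_subgroup_UNIV: "add_subgroup UNIV"
  by (simp add: add_subgroup_def)

lemma add_subgroup_Int: "add_subgroup V \<Longrightarrow> add_subgroup W \<Longrightarrow> add_subgroup (V \<inter> W)"
  by (auto simp: add_subgroup_def)

lemma add_subgroupD:
  assumes "add_subgroup W"
  shows "0 \<in> W" "x \<in> W \<Longrightarrow> y \<in> W \<Longrightarrow> x + y \<in> W" "x \<in> W \<Longrightarrow> - x \<in> W" "x \<in> W \<Longrightarrow> y \<in> W \<Longrightarrow> x - y \<in> W"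
    "x \<in> W \<Longrightarrow> y \<in> W \<Longrightarrow> conjugate x y \<in> W"
  using assms unfolding add_subgroup_def conjugate_def by (auto simp: diff_conv_add_uminus simp del: add_uminus_conv_diff)

lemma add_subgroup_cancel:
  assumes "add_subgroup W" "x \<in> W"
  shows "x + y \<in> W \<longleftrightarrow> y \<in> W" "y + x \<in> W \<longleftrightarrow> y \<in> W"
  using assms by (metis add_subgroupD(2,3) minus_add_cancel, metis add_subgroupD(2,3) add_diff_cancel diff_conv_add_uminus)

lemma commute_minus:
  fixes b c :: "'g::group_add"
  assumes "c + b = b + c"
  shows "c + - b = - b + c"
proof -
  have "- b + c = - b + (c + b + - b)" by (simp add: add.assoc)
  also have "\<dots> = - b + (b + (c + - b))" unfolding assms by (simp only: add.assoc)
  also have "\<dots> = c + - b" by (rule minus_add_cancel)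
  finally show ?thesis ..
qed

lemma commute_add:
  fixes a b c :: "'g::group_add"
  assumes "c + a = a + c" "c + b = b + c"
  shows "c + (a + b) = (a + b) + c"
proof -
  have "c + (a + b) = a + (c + b)" by (simp only: add.assoc[symmetric] assms(1))
  also have "\<dots> = (a + b) + c" by (simp only: assms(2) add.assoc)
  finally show ?thesis .
qed

section \<open>FC centers and their commutativity in the torsion-free case\<close>

lemma fc_center_subset: "fc_center W \<subseteq> W"
  by (auto simp: fc_center_def)

lemma finite_conjugate_add:
  assumes "finite ((\<lambda>w. conjugate w g) ` W)" "finite ((\<lambda>w. conjugate w h) ` W)"
  shows "finite ((\<lambda>w. conjugate w (g + h)) ` W)"
proof -
  have "(\<lambda>w. conjugate w (g + h)) ` W \<subseteq> (\<lambda>(a, b). a + b) ` ((\<lambda>w. conjugate w g) ` W \<times> (\<lambda>w. conjugate w h) ` W)"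
    by (auto simp: conjugate_add)
  then show ?thesis using assms by (meson finite_SigmaI finite_imageI finite_subset)
qed

lemma finite_conjugate_minus:
  assumes "finite ((\<lambda>w. conjugate w g) ` W)"
  shows "finite ((\<lambda>w. conjugate w (- g)) ` W)"
proof -
  have "(\<lambda>w. conjugate w (- g)) ` W = uminus ` (\<lambda>w. conjugate w g) ` W"
    by (simp add: conjugate_minus image_image)
  then show ?thesis using assms by simp
qed

lemma add_subgroup_fc_center:
  assumes W: "add_subgroup W"
  shows "add_subgroup (fc_center W)"
proof -
  have "0 \<in> fc_center W"
    using add_subgroupD[OF W] by (auto simp: fc_center_def intro: finite_subset[of _ "{0}"])
  then show ?thesis
    using add_subgroupD[OF W] finite_conjugate_add finite_conjugate_minus
    unfolding add_subgroup_def by (auto simp: fc_center_def)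
qed

lemma conjugate_fc_center:
  assumes W: "add_subgroup W" and g: "g \<in> fc_center W" and v: "v \<in> W"
  shows "conjugate v g \<in> fc_center W"
proof -
  have "(\<lambda>w. conjugate w (conjugate v g)) ` W \<subseteq> (\<lambda>w. conjugate w g) ` W"
    using add_subgroupD[OF W] v by (auto simp: conjugate_conjugate)
  then show ?thesis
    using g v add_subgroupD[OF W] by (auto simp: fc_center_def intro: finite_subset)
qed

text \<open>
  The transfer homomorphism into the centralizer \<open>Z\<close> of \<open>x\<close> and \<open>y\<close> kills the commutator of
  \<open>x\<close> and \<open>y\<close>, but acts on \<open>Z\<close> as a positive multiple of the identity; and some positive multiple of
  the commutator lies in \<open>Z\<close>. Cosets of \<open>Z\<close> are encoded as conjugates of the pair \<open>(x, y)\<close>.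
\<close>
lemma fc_center_commute:
  assumes tf: "torsion_free TYPE('g::group_add)"
    and W: "add_subgroup W" and x: "x \<in> fc_center W" and y: "(y::'g) \<in> fc_center W"
  shows "x + y = y + x"
proof -
  define Z0 where "Z0 = {z. z + x = x + z \<and> z + y = y + z}"
  \<comment> \<open>Allowing only elements that commute with all of \<open>Z0\<close> makes
    \<open>Z\<close> central in \<open>L\<close>; \<open>x\<close> and \<open>y\<close> remain in
    \<open>L\<close> because \<open>Z0\<close> centralizes them.\<close>
  define L where "L = {g \<in> W. \<forall>z\<in>Z0. z + g = g + z}"
  define Z where "Z = Z0 \<inter> L"
  define cj where "cj = (\<lambda>g (\<omega>::'g \<times> 'g). (conjugate g (fst \<omega>), conjugate g (snd \<omega>)))"
  define \<Omega> where "\<Omega> = (\<lambda>g. cj g (x, y)) ` L"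
  \<comment> \<open>\<open>s\<close> chooses representatives of the cosets of \<open>Z\<close> in
    \<open>L\<close>, \<open>t g \<omega>\<close> is the transfer factor at the coset \<omega>, and
    \<open>f\<close> multiplies these factors in the abelian group \<open>M\<close>.\<close>
  define s where "s = inv_into L (\<lambda>g. cj g (x, y))"
  define t where "t = (\<lambda>g \<omega>. - s (cj g \<omega>) + (g + s \<omega>))"
  define M where "M = \<lparr>carrier = Z, monoid.mult = (+), one = (0::'g)\<rparr>"
  define f where "f = (\<lambda>g. finprod M (t g) \<Omega>)"
  have Lsub: "add_subgroup L"
    unfolding add_subgroup_def L_def Z0_def
    using add_subgroupD(1,2,3)[OF W] by (auto intro: commute_add commute_minus simp del: add_uminus_conv_diff)
  have Z0sub: "add_subgroup Z0"
    unfolding add_subgroup_def Z0_def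
    by (auto intro: commute_add[symmetric] commute_minus[symmetric] simp del: add_uminus_conv_diff)
  have Zsub: "add_subgroup Z" unfolding Z_def by (intro add_subgroup_Int Lsub Z0sub)
  have xy: "x \<in> L" "y \<in> L" using x y fc_center_subset by (auto simp: L_def Z0_def)
  have LW: "L \<subseteq> W" by (auto simp: L_def)
  have cjcj: "cj g (cj h \<omega>) = cj (g + h) \<omega>" for g h \<omega>
    by (simp add: cj_def conjugate_conjugate)
  have cj0: "cj 0 \<omega> = \<omega>" for \<omega> by (simp add: cj_def)
  have fin: "finite \<Omega>"
  proof -
    have "\<Omega> \<subseteq> (\<lambda>w. conjugate w x) ` W \<times> (\<lambda>w. conjugate w y) ` W"
      using LW by (auto simp: \<Omega>_def cj_def)
    then show ?thesis using x y by (auto simp: fc_center_def intro: finite_subset)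
  qed
  have \<Omega>ne: "(x, y) \<in> \<Omega>" 
    unfolding \<Omega>_def using add_subgroupD(1)[OF Lsub] by (intro image_eqI[of _ _ 0]) (simp_all add: cj0)
  have cj\<Omega>: "cj g \<omega> \<in> \<Omega>" if "g \<in> L" "\<omega> \<in> \<Omega>" for g \<omega>
    using that add_subgroupD(2)[OF Lsub] unfolding \<Omega>_def by (auto simp: cjcj)
  have sL: "s \<omega> \<in> L" and cjs: "cj (s \<omega>) (x, y) = \<omega>" if "\<omega> \<in> \<Omega>" for \<omega>
    using that unfolding s_def \<Omega>_def by (auto intro: inv_into_into f_inv_into_f)
  have Z0I: "g \<in> Z0" if "cj g (x, y) = (x, y)" for g
    using that by (simp add: cj_def Z0_def conjugate_eq_self_iff)
  have tZ: "t g \<omega> \<in> Z" if g: "g \<in> L" and \<omega>: "\<omega> \<in> \<Omega>" for g \<omega>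
  proof -
    have "t g \<omega> \<in> L"
      unfolding t_def using add_subgroupD[OF Lsub] sL cj\<Omega> g \<omega> by auto
    moreover have "cj (t g \<omega>) (x, y) = cj (- s (cj g \<omega>)) (cj g \<omega>)"
      unfolding t_def using cjs[OF \<omega>] by (metis cjcj)
    moreover have "\<dots> = cj (- s (cj g \<omega>)) (cj (s (cj g \<omega>)) (x, y))"
      using cjs[OF cj\<Omega>[OF g \<omega>]] by simp
    ultimately show ?thesis using Z0I unfolding Z_def by (simp add: cjcj cj0)
  qed
  have comm: "a + b = b + a" if "a \<in> Z" "b \<in> L" for a b
    using that unfolding Z_def L_def by blast
  have ZL: "Z \<subseteq> L" by (auto simp: Z_def)
  interpret M: comm_group M
  proof (rule comm_groupI)
    fix a assume "a \<in> carrier M"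
    then show "\<exists>b\<in>carrier M. b \<otimes>\<^bsub>M\<^esub> a = \<one>\<^bsub>M\<^esub>"
      using add_subgroupD(3)[OF Zsub] by (auto simp: M_def intro!: bexI[of _ "- a"])
  next
    fix a b assume "a \<in> carrier M" "b \<in> carrier M"
    then show "a \<otimes>\<^bsub>M\<^esub> b = b \<otimes>\<^bsub>M\<^esub> a"
      using comm[of a b] ZL by (auto simp: M_def)
  qed (use add_subgroupD[OF Zsub] in \<open>simp_all add: M_def add.assoc\<close>)
  have Mmul: "a \<otimes>\<^bsub>M\<^esub> b = a + b" and Mone: "\<one>\<^bsub>M\<^esub> = 0" and Mcar: "carrier M = Z" for a b
    by (simp_all add: M_def)
  have fZ: "f g \<in> Z" if "g \<in> L" for g
    using M.finprod_closed[of "t g" \<Omega>] tZ[OF that] unfolding f_def Mcar by auto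
  have hom: "f (g + h) = f g + f h" if g: "g \<in> L" and h: "h \<in> L" for g h
  proof -
    \<comment> \<open>The representative \<open>s (cj h \<omega>)\<close> cancels in the middle.
      Since \<open>cj h\<close> permutes \<Omega>, the first factors multiply to
      \<open>f g\<close>.\<close>
    have split: "t (g + h) \<omega> = t g (cj h \<omega>) \<otimes>\<^bsub>M\<^esub> t h \<omega>" for \<omega>
      by (simp add: t_def Mmul cjcj add.assoc)
    have bij: "bij_betw (cj h) \<Omega> \<Omega>"
    proof (rule bij_betw_byWitness[of _ "cj (- h)"])
      show "\<forall>a\<in>\<Omega>. cj (- h) (cj h a) = a" "\<forall>a\<in>\<Omega>. cj h (cj (- h) a) = a"
        by (simp_all add: cjcj cj0)
      show "cj h ` \<Omega> \<subseteq> \<Omega>" "cj (- h) ` \<Omega> \<subseteq> \<Omega>"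
        using cj\<Omega> h add_subgroupD(3)[OF Lsub] by auto
    qed
    have "f (g + h) = finprod M (\<lambda>\<omega>. t g (cj h \<omega>) \<otimes>\<^bsub>M\<^esub> t h \<omega>) \<Omega>"
      unfolding f_def using split by (intro arg_cong[of _ _ "\<lambda>u. finprod M u \<Omega>"]) auto
    also have "\<dots> = finprod M (\<lambda>\<omega>. t g (cj h \<omega>)) \<Omega> \<otimes>\<^bsub>M\<^esub> finprod M (t h) \<Omega>"
      using tZ g h cj\<Omega> by (intro M.finprod_multf) (auto simp: Mcar)
    also have "finprod M (\<lambda>\<omega>. t g (cj h \<omega>)) \<Omega> = finprod M (t g) (cj h ` \<Omega>)"
      using bij tZ g cj\<Omega> h by (intro M.finprod_reindex[symmetric]) (auto simp: Mcar bij_betw_def)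
    finally show ?thesis using bij by (simp add: f_def Mmul bij_betw_def)
  qed
  have powM: "a [^]\<^bsub>M\<^esub> (n::nat) = mul n a" for a n
  proof (induction n)
    case (Suc n)
    then show ?case using mul_add[of n 1 a] by (simp add: Mmul)
  qed (simp add: Mone)
  have fz: "f z = mul (card \<Omega>) z" if z: "z \<in> Z" for z
  proof -
    \<comment> \<open>Being central in \<open>L\<close>, \<open>z\<close> fixes every coset and
      commutes with its representative.\<close>
    have "t z \<omega> = z" if \<omega>: "\<omega> \<in> \<Omega>" for \<omega>
    proof -
      have zs: "z + s \<omega> = s \<omega> + z" using comm[OF z] sL[OF \<omega>] by auto
      have "cj z (x, y) = (x, y)"
        using z by (simp add: cj_def Z_def Z0_def conjugate_eq_self_iff)
      then have "cj z \<omega> = \<omega>"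
        using cjs[OF \<omega>] zs by (metis cjcj)
      then show ?thesis by (simp add: t_def zs)
    qed
    then have "f z = finprod M (\<lambda>_. z) \<Omega>"
      unfolding f_def using z by (intro M.finprod_cong) (auto simp: Mcar simp_implies_def)
    also have "\<dots> = z [^]\<^bsub>M\<^esub> card \<Omega>"
      using z by (intro M.finprod_const) (simp add: Mcar)
    finally show ?thesis by (simp add: powM)
  qed
  define c where "c = x + y + - (y + x)"
  have cL: "c \<in> L" unfolding c_def by (intro add_subgroupD(2,3)[OF Lsub] xy)
  have "f x + f y = f (c + (y + x))"
    using hom[OF xy] by (simp add: c_def)
  also have "\<dots> = f c + (f y + f x)"
    using hom cL xy add_subgroupD(2)[OF Lsub] by auto
  finally have fc0: "f c = 0"
    using comm[OF fZ[OF xy(1)], of "f y"] fZ[OF xy(2)] ZL add_right_cancel[of 0 "f y + f x" "f c"] by auto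
  \<comment> \<open>Pigeonhole: the multiples of \<open>c\<close> move \<open>(x, y)\<close> within
    the finite orbit \<Omega>, so two of them agree there and a positive multiple of
    \<open>c\<close> lies in \<open>Z\<close>.\<close>
  have "\<not> inj (\<lambda>i. cj (mul i c) (x, y))"
  proof
    assume "inj (\<lambda>i. cj (mul i c) (x, y))"
    moreover have "range (\<lambda>i. cj (mul i c) (x, y)) \<subseteq> \<Omega>"
      using mul_mem[OF Lsub cL] by (auto simp: \<Omega>_def)
    ultimately show False
      using fin by (meson finite_imageD finite_subset infinite_UNIV_nat)
  qed
  then obtain i j where "i < j" and ij: "cj (mul i c) (x, y) = cj (mul j c) (x, y)"
    unfolding inj_def by (metis nat_neq_iff)
  define k where "k = j - i"
  have k: "k > 0" "j = i + k" using \<open>i < j\<close> by (auto simp: k_def)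
  have "cj (mul i c) (cj (mul k c) (x, y)) = cj (mul i c) (x, y)"
    using ij by (simp add: cjcj k(2) mul_add)
  then have "cj (mul k c) (x, y) = (x, y)"
    by (metis add.left_inverse cj0 cjcj)
  then have kZ: "mul k c \<in> Z" using Z0I mul_mem[OF Lsub cL] by (simp add: Z_def)
  have f0: "f 0 = 0" using hom[of 0 0] add_subgroupD(1)[OF Lsub] add_left_cancel[of "f 0" "f 0" 0] by simp
  have fmul: "f (mul n c) = 0" for n
    by (induction n) (simp_all add: f0 hom cL mul_mem[OF Lsub cL] fc0)
  have "mul (card \<Omega> * k) c = 0"
    using fmul[of k] fz[OF kZ] by (simp add: mul_mul)
  moreover have "card \<Omega> > 0" using fin \<Omega>ne by (auto simp: card_gt_0_iff)
  ultimately have "c = 0" using torsion_freeD[OF tf] k(1) by (metis nat_0_less_mult_iff)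
  then show ?thesis unfolding c_def by (metis diff_conv_add_uminus eq_iff_diff_eq_0)
qed

text \<open>A torsion-free abelian group can be totally ordered: by Zorn's lemma there is a maximal
  cone \<open>C\<close> of positive elements, and maximality makes it total. The largest elements
  \<open>p\<close> of \<open>P\<close> and \<open>q\<close> of \<open>Q\<close> then have a unique
  sum.\<close>

lemma unique_product:
  assumes tf: "torsion_free TYPE('g::group_add)"
    and H: "add_subgroup H" and comm: "\<And>a b. a \<in> H \<Longrightarrow> b \<in> H \<Longrightarrow> a + b = b + (a::'g)"
    and P: "finite P" "P \<noteq> {}" "P \<subseteq> H" and Q: "finite Q" "Q \<noteq> {}" "Q \<subseteq> H"
  obtains p q where "p \<in> P" "q \<in> Q"
    "\<And>p' q'. p' \<in> P \<Longrightarrow> q' \<in> Q \<Longrightarrow> p' + q' = p + q \<Longrightarrow> p' = p \<and> q' = q"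
proof -
  define \<C> where "\<C> = {C. C \<subseteq> H \<and> 0 \<notin> C \<and> (\<forall>a\<in>C. \<forall>b\<in>C. a + b \<in> C)}"
  have "\<exists>C\<in>\<C>. \<forall>C'\<in>\<C>. C \<subseteq> C' \<longrightarrow> C' = C"
  proof (rule subset_Zorn_nonempty)
    show "\<C> \<noteq> {}" by (auto simp: \<C>_def)
    fix \<D> assume ne: "\<D> \<noteq> {}" and ch: "subset.chain \<C> \<D>"
    then have "a + b \<in> \<Union>\<D>" if ab: "a \<in> \<Union>\<D>" "b \<in> \<Union>\<D>" for a b
    proof -
      obtain C C' where "C \<in> \<D>" "a \<in> C" "C' \<in> \<D>" "b \<in> C'" using ab by blast
      moreover from calculation have "C \<subseteq> C' \<or> C' \<subseteq> C" using ch unfolding subset_chain_def by blast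
      moreover from calculation have "C \<in> \<C>" "C' \<in> \<C>" using ch by (auto simp: subset_chain_def)
      ultimately show ?thesis unfolding \<C>_def by blast
    qed
    then show "\<Union>\<D> \<in> \<C>"
      using ch by (auto simp: \<C>_def subset_chain_def)
  qed
  then obtain C where C: "C \<in> \<C>" and max: "\<And>C'. C' \<in> \<C> \<Longrightarrow> C \<subseteq> C' \<Longrightarrow> C' = C" by blast
  have CH: "C \<subseteq> H" and C0: "0 \<notin> C" and Cadd: "\<And>a b. a \<in> C \<Longrightarrow> b \<in> C \<Longrightarrow> a + b \<in> C"
    using C by (auto simp: \<C>_def)
  have Cmul: "mul n a \<in> C" if "a \<in> C" "n > 0" for n a
    using that(2)
  proof (induction n rule: nat_induct_non_zero)
    case (Suc n)
    then show ?case using Cadd[OF that(1)] by simp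
  qed (use that(1) in simp)
  have ext: "\<exists>k>0. - mul k a \<in> C" if a: "a \<in> H" "a \<noteq> 0" "a \<notin> C" for a
  proof (rule ccontr)
    assume no: "\<not> ?thesis"
    \<comment> \<open>The cone generated by \<open>C\<close> and \<open>a\<close>. As
      \<open>C\<close> is maximal and \<open>a\<close> is new, \<open>C'\<close> must contain 0,
      which yields a relation between \<open>C\<close> and a multiple of \<open>a\<close>.\<close>
    define C' where "C' = C \<union> {c + mul k a | c k. c \<in> insert 0 C \<and> k > 0}"
    have mH: "mul k a \<in> H" for k using mul_mem[OF H a(1)] .
    have key: "c + mul k a + (d + mul l a) = (c + d) + mul (k + l) a" if "d \<in> insert 0 C" for c d k l
    proof -
      have "mul k a + d = d + mul k a" using comm mH that CH add_subgroupD(1)[OF H] by blast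
      then show ?thesis by (metis add.assoc mul_add)
    qed
    have insadd: "c + d \<in> insert 0 C" if "c \<in> insert 0 C" "d \<in> insert 0 C" for c d
      using that Cadd by auto
    have "c + d \<in> C'" if "c \<in> C'" "d \<in> C'" for c d
    proof -
      have repr: "\<exists>c k. e = c + mul k a \<and> c \<in> insert 0 C \<and> (k > 0 \<or> c \<in> C)" if "e \<in> C'" for e
        using that unfolding C'_def by (auto 0 4 intro: exI[of _ 0])
      obtain c' k where c: "c = c' + mul k a" "c' \<in> insert 0 C" "k > 0 \<or> c' \<in> C" using repr \<open>c \<in> C'\<close> by blast
      obtain d' l where d: "d = d' + mul l a" "d' \<in> insert 0 C" "l > 0 \<or> d' \<in> C" using repr \<open>d \<in> C'\<close> by blast
      have e: "c + d = (c' + d') + mul (k + l) a" using key c d by simp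
      have i: "c' + d' \<in> insert 0 C" using insadd c d by simp
      show ?thesis
      proof (cases "k + l > 0")
        case True
        then show ?thesis using e i unfolding C'_def by blast
      next
        case False
        then have "k = 0" "l = 0" by auto
        then show ?thesis using e c d Cadd by (auto simp: C'_def)
      qed
    qed
    moreover have "C' \<subseteq> H"
      using CH mH add_subgroupD[OF H] unfolding C'_def by auto
    moreover have "0 \<notin> C'"
    proof
      assume "0 \<in> C'"
      then obtain c k where ck: "c \<in> insert 0 C" "k > 0" "c + mul k a = 0"
        using C0 unfolding C'_def by auto
      \<comment> \<open>Torsion-freeness rules out that the relation involves \<open>a\<close>
        alone.\<close>
      have "mul k a \<noteq> 0" using torsion_freeD[OF tf ck(2)] a by auto
      then have "c \<in> C" using ck by auto
      moreover have "c = - mul k a" using ck(3) by (simp add: eq_neg_iff_add_eq_0)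
      ultimately show False using no ck(2) by blast
    qed
    ultimately have "C' \<in> \<C>" by (auto simp: \<C>_def)
    then have "C' = C" using max by (auto simp: C'_def)
    moreover have "0 + mul 1 a \<in> C'" unfolding C'_def by blast
    ultimately show False using a by simp
  qed
  have total: "a \<in> C \<or> - a \<in> C" if a: "a \<in> H" "a \<noteq> 0" for a
  proof (rule ccontr)
    assume "\<not> ?thesis"
    then obtain k l where kl: "k > 0" "- mul k a \<in> C" "l > 0" "- mul l (- a) \<in> C"
      using ext[of a] ext[of "- a"] a add_subgroupD(3)[OF H] by auto
    \<comment> \<open>Both \<open>- mul k a\<close> and \<open>mul l a\<close> lie in
      \<open>C\<close>; suitable multiples of the two cancel and would put 0 into
      \<open>C\<close>.\<close>
    then have "mul l (- mul k a) \<in> C" "mul k (mul l a) \<in> C"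
      using Cmul[OF kl(2,3)] Cmul[of "mul l a" k] kl by (simp_all add: mul_minus)
    then have "- mul (l * k) a + mul (l * k) a \<in> C"
      using Cadd by (metis mul_minus mul_mul mult.commute)
    then show False using C0 by simp
  qed
  have "\<exists>p\<in>P. \<forall>p'\<in>P. p' \<noteq> p \<longrightarrow> p - p' \<in> C" if "finite P" "P \<noteq> {}" "P \<subseteq> H" for P
    using that
  proof (induction rule: finite_ne_induct)
    case (insert a P)
    then obtain p where p: "p \<in> P" "\<And>p'. p' \<in> P \<Longrightarrow> p' \<noteq> p \<Longrightarrow> p - p' \<in> C" by auto
    have "p - a \<noteq> 0" using insert p by auto
    moreover have "p - a \<in> H" using insert.prems p add_subgroupD(4)[OF H] by auto
    ultimately consider "p - a \<in> C" | "- (p - a) \<in> C" using total by blast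
    then show ?case
    proof cases
      case 1
      then show ?thesis using p by auto
    next
      case 2
      then have ap: "a - p \<in> C" by simp
      have "a - p' \<in> C" if "p' \<in> P" for p'
      proof (cases "p' = p")
        case False
        then have "(a - p) + (p - p') \<in> C" using ap p that Cadd by blast
        then show ?thesis by (simp add: add_diff_eq)
      qed (use ap in simp)
      then show ?thesis by auto
    qed
  qed simp
  then obtain p q where p: "p \<in> P" "\<forall>p'\<in>P. p' \<noteq> p \<longrightarrow> p - p' \<in> C"
    and q: "q \<in> Q" "\<forall>q'\<in>Q. q' \<noteq> q \<longrightarrow> q - q' \<in> C"
    using P Q by meson
  have "p' = p \<and> q' = q" if "p' \<in> P" "q' \<in> Q" and e: "p' + q' = p + q" for p' q'
  proof (cases "p' = p")
    case True
    then show ?thesis using e by simp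
  next
    case False
    then have pC: "p - p' \<in> C" using p that by auto
    have "q' = - p' + (p + q)" using e by (metis minus_add_cancel)
    moreover have "- p' + p = p - p'"
      using comm[of "- p'" p] that p P add_subgroupD(3)[OF H] by auto
    ultimately have "q' = (p - p') + q" by (metis add.assoc)
    then have qe: "q - q' = - (p - p')" by (simp add: minus_add diff_conv_add_uminus del: add_uminus_conv_diff)
    have "q' \<noteq> q" using e False by auto
    then have "- (p - p') \<in> C" using q that qe by auto
    then have "- (p - p') + (p - p') \<in> C" using pC Cadd by blast
    then show ?thesis using C0 by (simp del: minus_diff_eq)
  qed
  then show ?thesis using that p q by blast
qed

text \<open>
  The set \<open>X k\<close> is covered by finitely many sets \<open>C \<phi>\<close>, each given by a finite partial map \<open>\<phi>\<close> on
  \<open>V\<close>, and intersecting \<open>X k\<close> with a translate replaces \<open>\<phi>\<close> by unions \<open>\<phi> \<union> act y \<psi>\<close>. Once the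
  domains are as large as possible and the number of \<open>\<phi>\<close> with smallest domain is as small as possible,
  every \<open>y \<in> Y k\<close> must permute these \<open>\<phi>\<close>.
\<close>
lemma conjugation_stabilizer:
  fixes X Y :: "'k \<Rightarrow> 'g::group_add set"
  assumes fin: "finite U" "finite V"
    and ne: "\<And>k. P k \<Longrightarrow> X k \<noteq> {}"
    and step: "\<And>k y. P k \<Longrightarrow> y \<in> Y k \<Longrightarrow> \<exists>k'. P k' \<and> X k' \<subseteq> X k \<inter> (+) y ` X k"
    and k0: "P k0" and cov: "\<And>x. x \<in> X k0 \<Longrightarrow> \<exists>v\<in>V. conjugate x v \<in> U"
  obtains k W u where "P k" "add_subgroup W" "Y k \<subseteq> W" "u \<in> U" "finite ((\<lambda>w. conjugate w u) ` W)"
proof -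
  \<comment> \<open>If nonempty, \<open>C \<phi>\<close> is a left coset of the centralizer of the
    domain of \<phi>; translating it by \<open>y\<close> gives
    \<open>C (act y \<phi>)\<close>.\<close>
  define C where "C = (\<lambda>\<phi>::('g \<times> 'g) set. {x. \<forall>(v, u)\<in>\<phi>. conjugate x v = u})"
  define act where "act = (\<lambda>y::'g. (`) (\<lambda>(v::'g, u). (v, conjugate y u)))"
  define good where "good = (\<lambda>k \<Phi>. P k \<and> finite \<Phi> \<and>
    (\<forall>\<phi>\<in>\<Phi>. \<phi> \<subseteq> V \<times> UNIV \<and> C \<phi> \<noteq> {} \<and> \<phi> \<inter> V \<times> U \<noteq> {}) \<and> X k \<subseteq> (\<Union>\<phi>\<in>\<Phi>. C \<phi>))"
  \<comment> \<open>Here \<open>m\<close> is just a lower bound for the sizes, so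
    \<open>m = 0\<close> can start the descent; at a lexicographic minimum it is attained, as
    \<open>Top\<close> being nonempty shows.\<close>
  define S where "S = {(card V - m, card {\<phi>\<in>\<Phi>. card \<phi> = m}) | k \<Phi> m.
    good k \<Phi> \<and> (\<forall>\<phi>\<in>\<Phi>. m \<le> card \<phi>)}"
  have small: "finite \<phi>" "card \<phi> \<le> card V" if \<phi>: "\<phi> \<subseteq> V \<times> UNIV" "C \<phi> \<noteq> {}" for \<phi>
  proof -
    obtain x where "x \<in> C \<phi>" using \<phi>(2) by blast
    then have sub: "\<phi> \<subseteq> (\<lambda>v. (v, conjugate x v)) ` V" using \<phi>(1) by (auto simp: C_def)
    show "finite \<phi>" using sub fin by (meson finite_imageI finite_subset)
    show "card \<phi> \<le> card V" by (rule surj_card_le[OF fin(2) sub])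
  qed
  have "good k0 {{(v, u)} | v u. v \<in> V \<and> u \<in> U \<and> C {(v, u)} \<noteq> {}}" (is "good k0 ?\<Phi>")
    unfolding good_def
  proof (intro conjI)
    have "?\<Phi> \<subseteq> (\<lambda>p. {p}) ` (V \<times> U)" by auto
    then show "finite ?\<Phi>" using fin by (meson finite_SigmaI finite_imageI finite_subset)
    show "X k0 \<subseteq> (\<Union>\<phi>\<in>?\<Phi>. C \<phi>)"
    proof
      fix x assume "x \<in> X k0"
      then obtain v where "v \<in> V" "conjugate x v \<in> U" using cov by blast
      moreover have "x \<in> C {(v, conjugate x v)}" by (simp add: C_def)
      ultimately show "x \<in> (\<Union>\<phi>\<in>?\<Phi>. C \<phi>)" by blast
    qed
  qed (use k0 in auto)
  then have S: "(card V - 0, card {\<phi>\<in>?\<Phi>. card \<phi> = 0}) \<in> S"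
    unfolding S_def by blast
  obtain p where p: "p \<in> S" and min: "\<And>q. (q, p) \<in> less_than <*lex*> less_than \<Longrightarrow> q \<notin> S"
    by (rule wfE_min[OF wf_lex_prod[OF wf_less_than wf_less_than] S]) blast
  obtain k \<Phi> m where kp: "p = (card V - m, card {\<phi>\<in>\<Phi>. card \<phi> = m})"
    and good: "good k \<Phi>" and m: "\<forall>\<phi>\<in>\<Phi>. m \<le> card \<phi>"
    using p unfolding S_def by blast
  define Top where "Top = {\<phi>\<in>\<Phi>. card \<phi> = m}"
  have P: "P k" and fin\<Phi>: "finite \<Phi>" and X: "X k \<subseteq> (\<Union>\<phi>\<in>\<Phi>. C \<phi>)"
    and \<Phi>: "\<And>\<phi>. \<phi> \<in> \<Phi> \<Longrightarrow> \<phi> \<subseteq> V \<times> UNIV" "\<And>\<phi>. \<phi> \<in> \<Phi> \<Longrightarrow> C \<phi> \<noteq> {}"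
      "\<And>\<phi>. \<phi> \<in> \<Phi> \<Longrightarrow> \<phi> \<inter> V \<times> U \<noteq> {}"
    using good by (auto simp: good_def)
  have finTop: "finite Top" using fin\<Phi> by (simp add: Top_def)
  have Top: "Top \<noteq> {}"
  proof
    assume "Top = {}"
    then have m': "\<forall>\<phi>\<in>\<Phi>. Suc m \<le> card \<phi>" using m unfolding Top_def
      by (metis (mono_tags, lifting) empty_Collect_eq le_neq_implies_less Suc_leI)
    obtain \<phi> where "\<phi> \<in> \<Phi>" using ne[OF P] X by blast
    \<comment> \<open>Needed so that the truncated difference \<open>card V - m\<close> really drops
      when \<open>m\<close> is raised.\<close>
    then have "Suc m \<le> card V" using m' small \<Phi> by (meson order_trans)
    moreover have "(card V - Suc m, card {\<phi>\<in>\<Phi>. card \<phi> = Suc m}) \<in> S"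
      using good m' unfolding S_def by blast
    ultimately show False
      using min[of "(card V - Suc m, card {\<phi>\<in>\<Phi>. card \<phi> = Suc m})"] diff_less_mono2[of m "Suc m" "card V"]
      by (auto simp: kp)
  qed
  have act_add: "act v (act w \<phi>) = act (v + w) \<phi>" for v w \<phi>
    by (force simp: act_def image_image conjugate_conjugate)
  have act_0: "act 0 \<phi> = \<phi>" for \<phi> by (force simp: act_def)
  have card_act: "card (act w \<phi>) = card \<phi>" for w \<phi>
    unfolding act_def by (rule card_image) (auto simp: inj_on_def dest: injD[OF inj_conjugate])
  have stab: "act y ` Top = Top" if y: "y \<in> Y k" for y
  proof -
    obtain k' where k': "P k'" "X k' \<subseteq> X k \<inter> (+) y ` X k" using step[OF P y] by blast
    define \<Phi>' where "\<Phi>' = {\<phi> \<union> act y \<psi> | \<phi> \<psi>. \<phi> \<in> \<Phi> \<and> \<psi> \<in> \<Phi> \<and> C (\<phi> \<union> act y \<psi>) \<noteq> {}}"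
    have sub: "\<phi> \<union> act y \<psi> \<subseteq> V \<times> UNIV" if "\<phi> \<in> \<Phi>" "\<psi> \<in> \<Phi>" for \<phi> \<psi>
      using \<Phi>(1) that by (fastforce simp: act_def)
    have "good k' \<Phi>'"
      unfolding good_def
    proof (intro conjI ballI)
      show "P k'" by fact
      have "\<Phi>' \<subseteq> (\<lambda>(\<phi>, \<psi>). \<phi> \<union> act y \<psi>) ` (\<Phi> \<times> \<Phi>)" by (auto simp: \<Phi>'_def)
      then show "finite \<Phi>'" using fin\<Phi> by (meson finite_SigmaI finite_imageI finite_subset)
      show "X k' \<subseteq> (\<Union>\<phi>\<in>\<Phi>'. C \<phi>)"
      proof
        fix x assume "x \<in> X k'"
        then obtain x' \<phi> \<psi> where x: "x = y + x'" and \<phi>: "\<phi> \<in> \<Phi>" "x \<in> C \<phi>" and \<psi>: "\<psi> \<in> \<Phi>" "x' \<in> C \<psi>"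
          using k'(2) X by blast
        have "x \<in> C (\<phi> \<union> act y \<psi>)"
          using \<phi>(2) \<psi>(2) by (auto simp: C_def act_def x conjugate_conjugate[symmetric])
        then show "x \<in> (\<Union>\<phi>\<in>\<Phi>'. C \<phi>)" using \<phi>(1) \<psi>(1) unfolding \<Phi>'_def by blast
      qed
      fix \<chi> assume "\<chi> \<in> \<Phi>'"
      then obtain \<phi> \<psi> where "\<chi> = \<phi> \<union> act y \<psi>" "\<phi> \<in> \<Phi>" "\<psi> \<in> \<Phi>" "C \<chi> \<noteq> {}"
        unfolding \<Phi>'_def by blast
      then show "\<chi> \<subseteq> V \<times> UNIV" "C \<chi> \<noteq> {}" "\<chi> \<inter> V \<times> U \<noteq> {}"
        using sub \<Phi>(3)[of \<phi>] by auto
    qed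
    \<comment> \<open>Both parts of a union have at least \<open>m\<close> elements, so a union of
      size \<open>m\<close> coincides with each of them.\<close>
    moreover have top': "m \<le> card \<chi> \<and> (card \<chi> = m \<longrightarrow> \<chi> \<in> Top \<inter> act y ` Top)" if \<chi>: "\<chi> \<in> \<Phi>'" for \<chi>
    proof -
      obtain \<phi> \<psi> where e: "\<chi> = \<phi> \<union> act y \<psi>" and mem: "\<phi> \<in> \<Phi>" "\<psi> \<in> \<Phi>" and "C \<chi> \<noteq> {}"
        using \<chi> unfolding \<Phi>'_def by blast
      then have fin\<chi>: "finite \<chi>" using small sub by blast
      have le: "m \<le> card \<phi>" "m \<le> card (act y \<psi>)" using m mem card_act by auto
      have subs: "\<phi> \<subseteq> \<chi>" "act y \<psi> \<subseteq> \<chi>" using e by auto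
      have "m \<le> card \<chi>" using le(1) card_mono[OF fin\<chi> subs(1)] by simp
      moreover have "\<chi> \<in> Top \<inter> act y ` Top" if "card \<chi> = m"
      proof -
        have "\<phi> = \<chi>" "act y \<psi> = \<chi>"
          using card_seteq[OF fin\<chi>] subs le that by auto
        then show ?thesis using mem that card_act[of y \<psi>] by (auto simp: Top_def)
      qed
      ultimately show ?thesis by blast
    qed
    ultimately have "(card V - m, card {\<chi>\<in>\<Phi>'. card \<chi> = m}) \<in> S"
      unfolding S_def by blast
    then have "card Top \<le> card {\<chi>\<in>\<Phi>'. card \<chi> = m}"
      using min by (force simp: kp Top_def)
    also have "\<dots> \<le> card (Top \<inter> act y ` Top)"
      using top' finTop by (intro card_mono) auto
    finally have "Top \<inter> act y ` Top = Top"
      using finTop by (intro card_seteq) auto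
    then have "Top \<subseteq> act y ` Top" by blast
    then show ?thesis using card_seteq[of "act y ` Top" Top] finTop card_image_le[OF finTop] by auto
  qed
  \<comment> \<open>The setwise stabilizer of the finite family \<open>Top\<close>: conjugates of
    \<open>u\<close> under \<open>W\<close> stay among the second components occurring in
    \<open>Top\<close>.\<close>
  define W where "W = {w. act w ` Top = Top}"
  have "add_subgroup W"
    unfolding add_subgroup_def
  proof (intro conjI ballI)
    fix v w assume vw: "v \<in> W" "w \<in> W"
    have "act (v + w) ` Top = act v ` act w ` Top" by (simp add: image_image act_add)
    then show "v + w \<in> W" using vw by (simp add: W_def)
    have "act (- v) ` Top = act (- v) ` act v ` Top" using vw by (simp add: W_def)
    then show "- v \<in> W" by (simp add: image_image act_add act_0 W_def)
  qed (simp add: W_def act_0)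
  moreover have "Y k \<subseteq> W" using stab by (auto simp: W_def)
  moreover obtain \<phi> v u where \<phi>: "\<phi> \<in> Top" "(v, u) \<in> \<phi>" and u: "u \<in> U"
    using Top \<Phi>(3) unfolding Top_def by blast
  moreover have "finite ((\<lambda>w. conjugate w u) ` W)"
  proof (rule finite_subset)
    show "(\<lambda>w. conjugate w u) ` W \<subseteq> snd ` \<Union>Top"
    proof clarify
      fix w assume "w \<in> W"
      then have "act w \<phi> \<in> Top" using \<phi> by (auto simp: W_def)
      moreover have "(v, conjugate w u) \<in> act w \<phi>" using \<phi> unfolding act_def by force
      ultimately show "conjugate w u \<in> snd ` \<Union>Top" by force
    qed
    show "finite (snd ` \<Union>Top)"
      using finTop small(1) \<Phi> by (intro finite_imageI finite_Union) (simp_all add: Top_def)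
  qed
  ultimately show thesis using that P by blast
qed

section \<open>Homogeneous products and separation in a \<open>G\<close>-prime ring\<close>

lemma ideal_prod_mem: "u \<in> U \<Longrightarrow> v \<in> V \<Longrightarrow> f u v \<in> finite_sums_of_products f U V"
  unfolding finite_sums_of_products_def
  by (intro CollectI exI[of _ "1::nat"] exI[of _ "\<lambda>_. u"] exI[of _ "\<lambda>_. v"]) simp

lemma ideal_prod_eq_zero_iff:
  assumes "U \<noteq> {}" "V \<noteq> {}"
  shows "finite_sums_of_products f U V = {0} \<longleftrightarrow> (\<forall>u\<in>U. \<forall>v\<in>V. f u v = 0)"
proof
  assume "finite_sums_of_products f U V = {0}"
  then show "\<forall>u\<in>U. \<forall>v\<in>V. f u v = 0" using ideal_prod_mem[of _ U _ V f] by auto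
next
  assume z: "\<forall>u\<in>U. \<forall>v\<in>V. f u v = 0"
  obtain u v where "u \<in> U" "v \<in> V" using assms by blast
  then have "0 \<in> finite_sums_of_products f U V"
    using ideal_prod_mem[of u U v V f] z by auto
  moreover have "finite_sums_of_products f U V \<subseteq> {0}"
    using z by (auto simp: finite_sums_of_products_def)
  ultimately show "finite_sums_of_products f U V = {0}" by blast
qed

lemma ring_idealD:
  assumes "ring_ideal I"
  shows "0 \<in> I" "x \<in> I \<Longrightarrow> y \<in> I \<Longrightarrow> x + y \<in> I" "x \<in> I \<Longrightarrow> - x \<in> I"
    "x \<in> I \<Longrightarrow> r * x \<in> I" "x \<in> I \<Longrightarrow> x * r \<in> I"
  using assms by (auto simp: is_ideal_def)

lemma ring_ideal_sum: "ring_ideal I \<Longrightarrow> (\<And>x. x \<in> A \<Longrightarrow> f x \<in> I) \<Longrightarrow> sum f A \<in> I"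
  by (induction A rule: infinite_finite_induct) (auto simp: ring_idealD)

context partial_action
begin

lemmas D_add = ring_idealD(2)[OF ideal_D]
  and D_minus = ring_idealD(3)[OF ideal_D]
  and D_mult_left = ring_idealD(4)[OF ideal_D]
  and D_mult_right = ring_idealD(5)[OF ideal_D]

lemma D_zero: "r \<in> D 0"
  by (simp add: P1)

text \<open>One factor of every summand is \<open>r\<close> itself, so distributivity collapses the
  sum supplied by s-unitality into a single product.\<close>

lemma left_unit:
  assumes "r \<in> D g"
  obtains e where "e \<in> D g" "e * r = r"
proof -
  obtain n :: nat and u v where r: "r = (\<Sum>i<n. u i * v i)" "\<forall>i<n. u i \<in> D g \<and> v i \<in> {r}"
    using s_unital_D[of g] assms unfolding s_unital_ring_def finite_sums_of_products_def by blast
  have "(\<Sum>i<n. u i) * r = (\<Sum>i<n. u i * v i)"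
    unfolding sum_distrib_right using r(2) by (intro sum.cong) auto
  then have "(\<Sum>i<n. u i) * r = r" using r(1) by (rule trans[OF _ sym])
  moreover have "(\<Sum>i<n. u i) \<in> D g" using r(2) by (intro ring_ideal_sum ideal_D) auto
  ultimately show thesis using that by blast
qed

lemma right_unit:
  assumes "r \<in> D g"
  obtains e where "e \<in> D g" "r * e = r"
proof -
  obtain n :: nat and u v where r: "r = (\<Sum>i<n. u i * v i)" "\<forall>i<n. u i \<in> {r} \<and> v i \<in> D g"
    using s_unital_D[of g] assms unfolding s_unital_ring_def finite_sums_of_products_def by blast
  have "r * (\<Sum>i<n. v i) = (\<Sum>i<n. u i * v i)"
    unfolding sum_distrib_left using r(2) by (intro sum.cong) auto
  then have "r * (\<Sum>i<n. v i) = r" using r(1) by (rule trans[OF _ sym])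
  moreover have "(\<Sum>i<n. v i) \<in> D g" using r(2) by (intro ring_ideal_sum ideal_D) auto
  ultimately show thesis using that by blast
qed

text \<open>An element of the intersection is its product with a right local unit from
  \<open>D g\<close>. Thus (P2), (P3) and invariance can be read with intersections in place of
  products.\<close>

lemma ideal_prod_D:
  assumes "ring_ideal I"
  shows "I \<odot> D g = I \<inter> D g"
proof
  show "I \<odot> D g \<subseteq> I \<inter> D g"
    unfolding finite_sums_of_products_def
    by (auto intro!: ring_ideal_sum assms ideal_D intro: ring_idealD[OF assms] D_mult_left)
  show "I \<inter> D g \<subseteq> I \<odot> D g"
  proof
    fix r assume r: "r \<in> I \<inter> D g"
    then obtain e where "e \<in> D g" "r * e = r" using right_unit[of r g] by blast
    then show "r \<in> I \<odot> D g" using r ideal_prod_mem[of r I e "D g" "(*)"] by simp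
  qed
qed

lemma alpha_add: "r \<in> D (- g) \<Longrightarrow> r' \<in> D (- g) \<Longrightarrow> \<alpha> g (r + r') = \<alpha> g r + \<alpha> g r'"
  and alpha_mult: "r \<in> D (- g) \<Longrightarrow> r' \<in> D (- g) \<Longrightarrow> \<alpha> g (r * r') = \<alpha> g r * \<alpha> g r'"
  and alpha_mem: "r \<in> D (- g) \<Longrightarrow> \<alpha> g r \<in> D g"
  and alpha_minus_mem: "r \<in> D g \<Longrightarrow> \<alpha> (- g) r \<in> D (- g)"
  using iso[of g] iso[of "- g"] by (auto simp: ring_iso_on_def bij_betw_def)

lemma alpha_mem_Int: "r \<in> D (- g) \<Longrightarrow> r \<in> D h \<Longrightarrow> \<alpha> g r \<in> D (g + h)"
  using P2[of g h] by (auto simp: ideal_prod_D[OF ideal_D])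

lemma alpha_alpha: "r \<in> D (- h) \<Longrightarrow> r \<in> D (- (g + h)) \<Longrightarrow> \<alpha> g (\<alpha> h r) = \<alpha> (g + h) r"
  by (rule P3) (simp add: ideal_prod_D[OF ideal_D])

lemma alpha_inverse: "r \<in> D (- g) \<Longrightarrow> \<alpha> (- g) (\<alpha> g r) = r" "r \<in> D g \<Longrightarrow> \<alpha> g (\<alpha> (- g) r) = r"
  using alpha_alpha[of r g "- g"] alpha_alpha[of r "- g" g] by (simp_all add: P1)

text \<open>The coefficient of \<open>(r \<delta>\<^sub>g) (r' \<delta>\<^sub>h)\<close>; it does not depend on \<open>h\<close>.\<close>

definition hm :: "'g \<Rightarrow> 'r \<Rightarrow> 'r \<Rightarrow> 'r" where
  "hm g r r' = \<alpha> g (\<alpha> (- g) r * r')"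

lemma hm_mem:
  assumes "r \<in> D g" "r' \<in> D h"
  shows "hm g r r' \<in> D (g + h)"
  unfolding hm_def using assms by (intro alpha_mem_Int D_mult_right D_mult_left alpha_minus_mem)

lemma hm_mem_left: "r \<in> D g \<Longrightarrow> hm g r r' \<in> D g"
  using hm_mem[of r g r' 0] by (simp add: D_zero)

lemma hm_zero [simp]: "hm g r 0 = 0" "hm g 0 r = 0"
  by (simp_all add: hm_def alpha_zero)

lemma hm_0_left [simp]: "hm 0 r r' = r * r'"
  by (simp add: hm_def P1)

lemma hm_add_right: "r \<in> D g \<Longrightarrow> hm g r (a + b) = hm g r a + hm g r b"
  by (simp add: hm_def distrib_left alpha_add D_mult_right alpha_minus_mem)

lemma hm_add_left: "r \<in> D g \<Longrightarrow> r' \<in> D g \<Longrightarrow> hm g (r + r') a = hm g r a + hm g r' a"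
  using alpha_add[of r "- g" r'] by (simp add: hm_def distrib_right alpha_add D_mult_right alpha_minus_mem)

text \<open>Associativity of the skew product on homogeneous elements. The obstacle is that
  \<open>d = \<alpha> (- g) r\<close> need not lie in \<open>D h\<close>, so it cannot be moved
  through \<open>\<alpha> h\<close> directly; with a left local unit \<open>e\<close> of
  \<open>r'\<close>, the product \<open>d * e\<close> can.\<close>

lemma hm_assoc:
  assumes r: "r \<in> D g" and r': "r' \<in> D h"
  shows "hm (g + h) (hm g r r') r'' = hm g r (hm h r' r'')"
proof -
  define d where "d = \<alpha> (- g) r"
  have d: "d \<in> D (- g)" using r by (simp add: d_def alpha_minus_mem)
  obtain e where e: "e \<in> D h" "e * r' = r'" using left_unit[OF r'] .
  have dr: "d * r' \<in> D (- g)" "d * r' \<in> D h" using d r' by (auto intro: D_mult_left D_mult_right)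
  have p': "\<alpha> (- h) r' \<in> D (- h)" "\<alpha> (- h) e \<in> D (- h)" "\<alpha> (- h) (d * e) \<in> D (- h)"
    using r' e by (auto intro: alpha_minus_mem D_mult_left)
  have "- (g + h) + g = - h" by (simp add: minus_add add.assoc)
  then have "\<alpha> (- (g + h)) (\<alpha> g (d * r')) = \<alpha> (- h) (d * r')"
    using alpha_alpha[of "d * r'" g "- (g + h)"] dr by simp
  then have "hm (g + h) (hm g r r') r'' = \<alpha> (g + h) (\<alpha> (- h) (d * r') * r'')"
    by (simp add: hm_def d_def)
  also have "\<dots> = \<alpha> g (\<alpha> h (\<alpha> (- h) (d * r') * r''))"
  proof (rule alpha_alpha[symmetric])
    have "\<alpha> (- h) (d * r') \<in> D (- h + - g)"
      by (rule alpha_mem_Int) (use dr in auto)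
    then show "\<alpha> (- h) (d * r') * r'' \<in> D (- (g + h))"
      by (simp only: minus_add D_mult_right)
    show "\<alpha> (- h) (d * r') * r'' \<in> D (- h)"
      using dr by (intro D_mult_right[OF alpha_minus_mem])
  qed
  also have "\<alpha> h (\<alpha> (- h) (d * r') * r'') = d * \<alpha> h (\<alpha> (- h) r' * r'')"
  proof -
    have "\<alpha> (- h) (d * r') = \<alpha> (- h) (d * e) * \<alpha> (- h) r'"
      using alpha_mult[of "d * e" "- h" r'] e r' by (simp add: mult.assoc D_mult_left)
    then have "\<alpha> h (\<alpha> (- h) (d * r') * r'') = \<alpha> h (\<alpha> (- h) (d * e)) * \<alpha> h (\<alpha> (- h) r' * r'')"
      using p' alpha_mult[of "\<alpha> (- h) (d * e)" h "\<alpha> (- h) r' * r''"] by (simp add: mult.assoc D_mult_right)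
    also have "\<dots> = d * (\<alpha> h (\<alpha> (- h) e) * \<alpha> h (\<alpha> (- h) r' * r''))"
      using e by (simp add: alpha_inverse D_mult_left mult.assoc)
    also have "\<alpha> h (\<alpha> (- h) e) * \<alpha> h (\<alpha> (- h) r' * r'') = \<alpha> h (\<alpha> (- h) e * \<alpha> (- h) r' * r'')"
      using p' alpha_mult[of "\<alpha> (- h) e" h "\<alpha> (- h) r' * r''"] by (simp add: mult.assoc D_mult_right)
    also have "\<alpha> (- h) e * \<alpha> (- h) r' = \<alpha> (- h) r'"
      using alpha_mult[of e "- h" r'] e r' by simp
    finally show ?thesis .
  qed
  finally show ?thesis by (simp add: hm_def d_def)
qed

text \<open>A right local unit of \<open>\<alpha> (- g) r\<close> works. It serves to shift a
  coefficient from degree \<open>g\<close> to degree 0 without killing it.\<close>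

lemma hm_nondegenerate:
  assumes r: "r \<in> D g" "r \<noteq> 0"
  obtains t where "t \<in> D (- g)" "hm g r t \<noteq> 0"
proof -
  obtain t where t: "t \<in> D (- g)" "\<alpha> (- g) r * t = \<alpha> (- g) r"
    using right_unit[OF alpha_minus_mem[OF r(1)]] .
  then have "hm g r t = r" using r by (simp add: hm_def alpha_inverse)
  then show thesis using that[OF t(1)] r by simp
qed

lemma hm_mult_left: "s \<in> D x \<Longrightarrow> hm x (r * s) r' = r * hm x s r'"
  using hm_assoc[of r 0 s x r'] by (simp add: D_zero)

lemma hm_mult_middle: "s \<in> D x \<Longrightarrow> hm x (hm x s r) r' = hm x s (r * r')"
  using hm_assoc[of s x r 0 r'] by (simp add: D_zero)

text \<open>Local units express \<open>\<alpha> g r\<close> as a product (s \<delta>_g) r (t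
  \<delta>_{-g}), which reduces invariance of an ideal to associativity.\<close>

lemma alpha_eq_hm:
  assumes "r \<in> D (- g)"
  obtains s t where "s \<in> D g" "t \<in> D (- g)" "\<alpha> g r = hm g (hm g s r) t"
proof -
  obtain d where d: "d \<in> D (- g)" "d * r = r" using left_unit[OF assms] .
  obtain t where t: "t \<in> D (- g)" "r * t = r" using right_unit[OF assms] .
  have "hm g (\<alpha> g d) r = \<alpha> g r" using d by (simp add: hm_def alpha_inverse)
  then have "hm g (hm g (\<alpha> g d) r) t = \<alpha> g r"
    using assms t by (simp add: hm_def alpha_inverse)
  then show thesis using that[of "\<alpha> g d" t] d t by (simp add: alpha_mem)
qed

text \<open>\<open>N\<close> consists of the \<open>n\<close> for which n (D_x \<delta>_x) c
  vanishes for all \<open>x\<close>, and \<open>M\<close> is its counterpart on the right. Both are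
  invariant ideals and their product is zero, so one is zero; since \<open>M\<close> contains the
  nonzero \<open>c\<close>, it is \<open>N\<close>, and \<open>a\<close> lies outside it.\<close>

lemma G_prime_separation:
  assumes prime: "G_prime D \<alpha>" and ac: "a \<noteq> 0" "c \<noteq> 0"
  obtains x s where "s \<in> D x" "hm x (a * s) c \<noteq> 0"
proof -
  define N where "N = {n. \<forall>x. \<forall>s\<in>D x. hm x (n * s) c = 0}"
  define M where "M = {b. \<forall>n\<in>N. \<forall>x. \<forall>s\<in>D x. hm x (n * s) b = 0}"
  have hm_minus_left: "hm x (- u) b = - hm x u b" if "u \<in> D x" for x u b
    using hm_add_left[of u x "- u" b] that by (simp add: D_minus eq_neg_iff_add_eq_0 add.commute)
  have hm_minus_right: "hm x u (- b) = - hm x u b" if "u \<in> D x" for x u b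
    using hm_add_right[of u x b "- b"] that by (simp add: eq_neg_iff_add_eq_0 add.commute)
  have N: "ring_ideal N"
    unfolding is_ideal_def
  proof (intro conjI ballI)
    fix n t assume n: "n \<in> N"
    then show "- n \<in> N" by (auto simp: N_def hm_minus_left D_mult_left)
    show "t * n \<in> N" using n by (auto simp: N_def mult.assoc hm_mult_left D_mult_left)
    show "n * t \<in> N" using n by (auto simp: N_def mult.assoc D_mult_left)
  qed (auto simp: N_def distrib_right hm_add_left D_mult_left)
  have M: "ring_ideal M"
    unfolding is_ideal_def
  proof (intro conjI ballI)
    fix b t assume b: "b \<in> M"
    then show "- b \<in> M" by (auto simp: M_def hm_minus_right D_mult_left)
    show "t * b \<in> M"
      unfolding M_def
    proof (intro CollectI ballI allI)
      fix n x s assume "n \<in> N" and s: "s \<in> D x"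
      then have "hm x (n * hm x s t) b = 0" using b hm_mem_left[OF s] by (auto simp: M_def)
      then show "hm x (n * s) (t * b) = 0" using s by (simp add: hm_mult_left hm_mult_middle hm_mem_left)
    qed
    show "b * t \<in> M"
      unfolding M_def
    proof (intro CollectI ballI allI)
      fix n x s assume "n \<in> N" and s: "s \<in> D x"
      then have "hm x (n * s) b = 0" using b by (auto simp: M_def)
      then show "hm x (n * s) (b * t) = 0"
        using hm_mult_middle[of "n * s" x b t] D_mult_left[OF s] by simp
    qed
  qed (auto simp: M_def hm_add_right D_mult_left)
  have "\<alpha> g n \<in> N" if n: "n \<in> N" "n \<in> D (- g)" for g n
    unfolding N_def
  proof (intro CollectI ballI allI)
    fix x s assume s: "s \<in> D x"
    obtain r t where rt: "r \<in> D g" "t \<in> D (- g)" and e: "\<alpha> g n = hm g (hm g r n) t"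
      using alpha_eq_hm[OF n(2)] .
    have rn: "hm g r n \<in> D g" using rt by (simp add: hm_mem_left)
    have s': "hm (- g) t s \<in> D (- g + x)" using rt s by (intro hm_mem)
    have "\<alpha> g n * s = hm g (hm g r n) (hm (- g) t s)"
      using hm_assoc[OF rn rt(2), of s] e by simp
    also have "\<dots> = hm g r (n * hm (- g) t s)"
      using rt by (simp add: hm_mult_middle)
    finally have "hm x (\<alpha> g n * s) c = hm (g + (- g + x)) (hm g r (n * hm (- g) t s)) c"
      by (simp add: add.assoc[symmetric])
    also have "\<dots> = hm g r (hm (- g + x) (n * hm (- g) t s) c)"
      using rt s' by (intro hm_assoc D_mult_left)
    also have "hm (- g + x) (n * hm (- g) t s) c = 0"
      using n s' by (auto simp: N_def)
    finally show "hm x (\<alpha> g n * s) c = 0" by simp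
  qed
  then have GN: "G_invariant D \<alpha> N"
    by (auto simp: G_invariant_def ideal_prod_D[OF N])
  have "\<alpha> g b \<in> M" if b: "b \<in> M" "b \<in> D (- g)" for g b
    unfolding M_def
  proof (intro CollectI ballI allI)
    fix n x s assume n: "n \<in> N" and s: "s \<in> D x"
    obtain r t where rt: "r \<in> D g" "t \<in> D (- g)" and e: "\<alpha> g b = hm g (hm g r b) t"
      using alpha_eq_hm[OF b(2)] .
    have ns: "n * s \<in> D x" using s by (rule D_mult_left)
    have "hm x (n * s) (\<alpha> g b) = hm (x + g) (hm x (n * s) (hm g r b)) t"
      using hm_assoc[OF ns hm_mem_left[OF rt(1)]] e by simp
    also have "hm x (n * s) (hm g r b) = hm (x + g) (n * hm x s r) b"
      using hm_assoc[OF ns rt(1)] s by (simp add: hm_mult_left)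
    also have "\<dots> = 0" using b n hm_mem[OF s rt(1)] by (auto simp: M_def)
    finally show "hm x (n * s) (\<alpha> g b) = 0" by simp
  qed
  then have GM: "G_invariant D \<alpha> M"
    by (auto simp: G_invariant_def ideal_prod_D[OF M])
  have "n * b = 0" if "n \<in> N" "b \<in> M" for n b
  proof -
    obtain e where "e * b = b" using left_unit[of b 0] D_zero by blast
    moreover have "hm 0 (n * e) b = 0" using that D_zero[of e] unfolding M_def by blast
    ultimately show ?thesis by (simp add: mult.assoc)
  qed
  then have "N \<odot> M = {0}"
    using ring_idealD(1)[OF N] ring_idealD(1)[OF M] by (subst ideal_prod_eq_zero_iff) auto
  then have "N = {0} \<or> M = {0}" using prime N M GN GM by (auto simp: G_prime_def)
  moreover have "c \<in> M" by (auto simp: M_def N_def)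
  ultimately have "a \<notin> N" using ac by auto
  then show thesis using that by (auto simp: N_def)
qed

end

section \<open>Ideals of the partial skew group ring\<close>

abbreviation (input) lookup where "lookup \<equiv> Poly_Mapping.lookup"
abbreviation (input) keys where "keys \<equiv> Poly_Mapping.keys"
abbreviation (input) single where "single \<equiv> Poly_Mapping.single"

definition min_support :: "('g \<Rightarrow>\<^sub>0 'r::zero) set \<Rightarrow> nat" where
  "min_support A = (LEAST n. \<exists>a\<in>A. a \<noteq> 0 \<and> card (keys a) = n)"

definition coeffs :: "('g::zero \<Rightarrow>\<^sub>0 'r::zero) set \<Rightarrow> 'g set \<Rightarrow> 'r set" where
  "coeffs A F = {lookup a 0 | a. a \<in> A \<and> keys a \<subseteq> F}"

text \<open>A coefficient vanishing on \<open>F\<close> makes the support a proper subset of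
  \<open>F\<close>, too small for a nonzero element of \<open>A\<close>.\<close>

lemma min_support_eq_0:
  assumes a: "a \<in> A" "keys a \<subseteq> F" and F: "finite F" "card F = min_support A"
    and f: "f \<in> F" "lookup a f = 0"
  shows "a = 0"
proof (rule ccontr)
  assume "a \<noteq> 0"
  then have "min_support A \<le> card (keys a)"
    unfolding min_support_def using a(1) by (intro Least_le) blast
  moreover have "keys a \<subset> F" using a f by (auto simp: in_keys_iff)
  then have "card (keys a) < card F" by (rule psubset_card_mono[OF F(1)])
  ultimately show False using F(2) by simp
qed

context partial_action
begin

abbreviation skew_ideal :: "('g \<Rightarrow>\<^sub>0 'r) set \<Rightarrow> bool" where
  "skew_ideal A \<equiv> is_ideal (skew_carrier D) (skew_mult \<alpha>) A"

text \<open>The degrees \<open>x\<close> for which k (D_x \<delta>_x) l is nonzero in the skew group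
  ring.\<close>

definition linked :: "'r \<Rightarrow> 'r \<Rightarrow> 'g set" where
  "linked k l = {x. \<exists>s\<in>D x. hm x (k * s) l \<noteq> 0}"

lemma linkedI: "s \<in> D x \<Longrightarrow> hm x (k * s) l \<noteq> 0 \<Longrightarrow> x \<in> linked k l"
  by (auto simp: linked_def)

lemma lookup_skew_mult:
  "lookup (skew_mult \<alpha> x y) z = (\<Sum>g\<in>keys x. hm g (lookup x g) (lookup y (- g + z)))"
proof -
  have "(\<Sum>h\<in>keys y. lookup (single (g + h) (hm g (lookup x g) (lookup y h))) z)
      = hm g (lookup x g) (lookup y (- g + z))" for g
  proof -
    have eq: "g + h = z \<longleftrightarrow> h = - g + z" for h
      by (metis add_minus_cancel minus_add_cancel)
    have "(\<Sum>h\<in>keys y. lookup (single (g + h) (hm g (lookup x g) (lookup y h))) z)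
        = (\<Sum>h\<in>keys y. if h = - g + z then hm g (lookup x g) (lookup y h) else 0)"
      by (intro sum.cong refl) (simp only: lookup_single when_def eq)
    also have "\<dots> = (if - g + z \<in> keys y then hm g (lookup x g) (lookup y (- g + z)) else 0)"
      by (rule sum.delta) simp
    finally show ?thesis by (simp add: in_keys_iff)
  qed
  then show ?thesis by (simp add: skew_mult_def hm_def lookup_sum)
qed

lemma single_skew_carrier: "r \<in> D g \<Longrightarrow> single g r \<in> skew_carrier D"
  using zero_D by (auto simp: skew_carrier_def lookup_single when_def)

lemma lookup_single_skew_mult:
  "lookup (skew_mult \<alpha> (single g r) a) z = hm g r (lookup a (- g + z))"
  by (cases "r = 0") (simp_all add: lookup_skew_mult)

lemma lookup_skew_mult_single:
  "lookup (skew_mult \<alpha> a (single g r)) z = hm (z - g) (lookup a (z - g)) r"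
proof -
  have eq: "g = - f + z \<longleftrightarrow> f = z - g" for f
    by (metis add_diff_cancel add_minus_cancel diff_add_cancel minus_add_cancel)
  have "lookup (skew_mult \<alpha> a (single g r)) z
      = (\<Sum>f\<in>keys a. if f = z - g then hm f (lookup a f) r else 0)"
    unfolding lookup_skew_mult
    by (intro sum.cong refl) (auto simp only: lookup_single when_def eq hm_zero split: if_splits)
  also have "\<dots> = (if z - g \<in> keys a then hm (z - g) (lookup a (z - g)) r else 0)"
    by (rule sum.delta) simp
  finally show ?thesis by (simp add: in_keys_iff)
qed

lemma keys_single_skew_mult: "z \<in> keys (skew_mult \<alpha> (single g r) a) \<Longrightarrow> - g + z \<in> keys a"
  unfolding in_keys_iff lookup_single_skew_mult by (metis hm_zero(1))

lemma keys_skew_mult_single: "z \<in> keys (skew_mult \<alpha> a (single g r)) \<Longrightarrow> z - g \<in> keys a"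
  unfolding in_keys_iff lookup_skew_mult_single by (metis hm_zero(2))

lemma skew_idealD:
  assumes "skew_ideal A" "a \<in> A"
  shows "lookup a g \<in> D g" "r \<in> D g \<Longrightarrow> skew_mult \<alpha> (single g r) a \<in> A"
    "r \<in> D g \<Longrightarrow> skew_mult \<alpha> a (single g r) \<in> A"
  using assms single_skew_carrier unfolding is_ideal_def skew_carrier_def by blast+

text \<open>Right multiplication by r \<delta>_0 moves no degree, so a coefficient can be replaced
  by a right multiple while \<open>F\<close> stays fixed.\<close>

lemma coeffs_mult:
  assumes A: "skew_ideal A" and k: "k \<in> coeffs A F"
  shows "k * r \<in> coeffs A F"
proof -
  obtain a where a: "a \<in> A" "keys a \<subseteq> F" "k = lookup a 0" using k by (auto simp: coeffs_def)
  let ?b = "skew_mult \<alpha> a (single 0 r)"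
  have "?b \<in> A" by (rule skew_idealD(3)[OF A a(1) D_zero])
  moreover have "keys ?b \<subseteq> F" using a(2) keys_skew_mult_single[of _ a 0 r] by auto
  moreover have "lookup ?b 0 = k * r" by (simp add: lookup_skew_mult_single a)
  ultimately show ?thesis unfolding coeffs_def by (metis (mono_tags, lifting) mem_Collect_eq)
qed

text \<open>A nonzero coefficient of a minimal element is shifted to degree 0 by a homogeneous right
  factor; this translates the support and cannot enlarge it.\<close>

lemma exists_min_support:
  assumes A: "skew_ideal A" "A \<noteq> {0}"
  obtains a where "a \<in> A" "lookup a 0 \<noteq> 0" "card (keys a) = min_support A"
proof -
  have "0 \<in> A" using A by (simp add: is_ideal_def)
  then have "\<exists>n. \<exists>a\<in>A. a \<noteq> 0 \<and> card (keys a) = n" using A(2) by blast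
  then have "\<exists>a\<in>A. a \<noteq> 0 \<and> card (keys a) = min_support A"
    unfolding min_support_def by (rule LeastI_ex)
  then obtain a where a: "a \<in> A" "a \<noteq> 0" "card (keys a) = min_support A" by blast
  then obtain g where g: "lookup a g \<noteq> 0" by (metis lookup_not_eq_zero_eq_in_keys keys_eq_empty ex_in_conv)
  obtain t where t: "t \<in> D (- g)" "hm g (lookup a g) t \<noteq> 0"
    using hm_nondegenerate[OF skew_idealD(1)[OF A(1) a(1)] g] .
  let ?b = "skew_mult \<alpha> a (single (- g) t)"
  have b: "?b \<in> A" "lookup ?b 0 \<noteq> 0"
    using skew_idealD(3)[OF A(1) a(1) t(1)] t(2) by (simp_all add: lookup_skew_mult_single)
  have "keys ?b \<subseteq> (\<lambda>f. f + - g) ` keys a"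
  proof
    fix z assume "z \<in> keys ?b"
    then have "z + g \<in> keys a" using keys_skew_mult_single[of z a "- g" t] by simp
    then show "z \<in> (\<lambda>f. f + - g) ` keys a" by (intro image_eqI[of _ _ "z + g"]) simp_all
  qed
  then have "card (keys ?b) \<le> card (keys a)"
    by (meson card_image_le card_mono finite_imageI finite_keys le_trans)
  moreover have "min_support A \<le> card (keys ?b)"
    unfolding min_support_def using b by (intro Least_le bexI[of _ ?b]) auto
  ultimately show thesis using that b a(3) by (metis le_antisym)
qed

text \<open>
  If \<open>g + x + h\<close> is a unique product, then \<open>a\<^sub>g s b\<^sub>h = 0\<close> for all \<open>s \<in> D\<^sub>x \<delta>\<^sub>x\<close>; minimality of the
  supports transfers this annihilation from \<open>a\<^sub>g\<close> to \<open>k = a\<^sub>0\<close> and then from \<open>b\<^sub>h\<close> to \<open>l = b\<^sub>0\<close>.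
\<close>
lemma linked_not_unique_product:
  assumes A: "skew_ideal A" and B: "skew_ideal B"
    and AB: "\<And>a b. a \<in> A \<Longrightarrow> b \<in> B \<Longrightarrow> skew_mult \<alpha> a b = 0"
    and F: "finite F" "card F = min_support A" and E: "finite E" "card E = min_support B"
    and k: "k \<in> coeffs A F" and l: "l \<in> coeffs B E" and x: "x \<in> linked k l"
    and g: "g \<in> F" and h: "h \<in> E"
  shows "\<exists>g'\<in>F. \<exists>h'\<in>E. (g', h') \<noteq> (g, h) \<and> g' + x + h' = g + x + h"
proof (rule ccontr)
  assume "\<not> ?thesis"
  then have uniq: "g' = g \<and> h' = h" if "g' \<in> F" "h' \<in> E" "g' + x + h' = g + x + h" for g' h'
    using that by blast
  obtain a where a: "a \<in> A" "keys a \<subseteq> F" "k = lookup a 0" using k by (auto simp: coeffs_def)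
  obtain b where b: "b \<in> B" "keys b \<subseteq> E" "l = lookup b 0" using l by (auto simp: coeffs_def)
  have ag: "lookup a g \<in> D g" by (rule skew_idealD(1)[OF A a(1)])
  have bh: "lookup b h \<in> D h" by (rule skew_idealD(1)[OF B b(1)])
  have 1: "hm (g + x) (hm g (lookup a g) \<sigma>) (lookup b h) = 0" if \<sigma>: "\<sigma> \<in> D x" for \<sigma>
  proof -
    define z where "z = g + x + h"
    define c where "c = skew_mult \<alpha> a (single x \<sigma>)"
    \<comment> \<open>A nonzero \<open>T f\<close> factors \<open>z\<close> through \<open>F\<close>
      and \<open>E\<close>, so uniqueness leaves only the term at \<open>f = g + x\<close>.\<close>
    define T where "T = (\<lambda>f. hm f (lookup c f) (lookup b (- f + z)))"
    have "skew_mult \<alpha> c b = 0"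
      unfolding c_def by (rule AB[OF skew_idealD(3)[OF A a(1) \<sigma>] b(1)])
    then have "0 = (\<Sum>f\<in>keys c. T f)" using lookup_skew_mult[of c b z] by (simp add: T_def)
    also have "\<dots> = (\<Sum>f\<in>keys c. if f = g + x then T f else 0)"
    proof (intro sum.cong refl)
      fix f
      have "f = g + x" if "T f \<noteq> 0"
      proof -
        have "f \<in> keys c" "- f + z \<in> keys b" using that by (auto simp: T_def in_keys_iff)
        then have "f - x \<in> F" "- f + z \<in> E"
          using a(2) b(2) keys_skew_mult_single[of f a x \<sigma>] by (auto simp: c_def)
        moreover have "f - x + x + (- f + z) = g + x + h" by (simp add: z_def)
        ultimately have "f - x = g" using uniq by blast
        then show ?thesis by (metis diff_add_cancel)
      qed
      then show "T f = (if f = g + x then T f else 0)" by auto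
    qed
    also have "\<dots> = (if g + x \<in> keys c then T (g + x) else 0)" by (rule sum.delta) simp
    also have "\<dots> = T (g + x)" by (simp add: T_def in_keys_iff)
    also have "\<dots> = hm (g + x) (hm g (lookup a g) \<sigma>) (lookup b h)"
    proof -
      have "- (g + x) + z = h" by (simp only: z_def minus_add_cancel)
      then show ?thesis by (simp add: T_def c_def lookup_skew_mult_single)
    qed
    finally show ?thesis ..
  qed
  have 2: "hm x (k * \<sigma>) (lookup b h) = 0" if \<sigma>: "\<sigma> \<in> D x" for \<sigma>
  proof (rule ccontr)
    define \<rho> where "\<rho> = hm x \<sigma> (lookup b h)"
    have \<rho>: "\<rho> \<in> D (x + h)" unfolding \<rho>_def by (rule hm_mem[OF \<sigma> bh])
    assume "hm x (k * \<sigma>) (lookup b h) \<noteq> 0"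
    then have "k * \<rho> \<noteq> 0" by (simp add: hm_mult_left[OF \<sigma>] \<rho>_def)
    then obtain t where t: "t \<in> D (- (x + h))" "hm (x + h) (k * \<rho>) t \<noteq> 0"
      using hm_nondegenerate[OF D_mult_left[OF \<rho>]] by blast
    \<comment> \<open>Multiplying \<open>a\<close> by \<open>r\<close> on the right kills its
      coefficient at \<open>g\<close> but not the one at 0, against minimality of
      \<open>F\<close>.\<close>
    define r where "r = hm (x + h) \<rho> t"
    have kr: "k * r \<noteq> 0" using t(2) by (simp add: hm_mult_left[OF \<rho>] r_def)
    let ?c = "skew_mult \<alpha> a (single 0 r)"
    have "hm g (lookup a g) \<rho> = 0"
      using 1[OF \<sigma>] hm_assoc[OF ag \<sigma>] by (simp add: \<rho>_def)
    then have "lookup ?c g = 0"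
      using hm_assoc[OF ag \<rho>, of t] by (simp add: lookup_skew_mult_single r_def)
    moreover have "?c \<in> A" by (rule skew_idealD(3)[OF A a(1) D_zero])
    moreover have "keys ?c \<subseteq> F" using a(2) keys_skew_mult_single[of _ a 0 r] by auto
    ultimately have "?c = 0" using min_support_eq_0[of ?c A F g] F g by simp
    moreover have "lookup ?c 0 = k * r" by (simp add: lookup_skew_mult_single a(3))
    ultimately show False using kr by simp
  qed
  obtain s where s: "s \<in> D x" "hm x (k * s) l \<noteq> 0" using x by (auto simp: linked_def)
  \<comment> \<open>The mirror argument for \<open>B\<close>: the coefficient at
    \<open>x + h\<close> vanishes while the one at \<open>x\<close> survives.\<close>
  let ?c = "skew_mult \<alpha> (single x (k * s)) b"
  have "lookup ?c (x + h) = 0" using 2[OF s(1)] by (simp add: lookup_single_skew_mult)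
  moreover have "?c \<in> B" by (intro skew_idealD(2)[OF B b(1)] D_mult_left s)
  moreover have "keys ?c \<subseteq> (+) x ` E"
  proof
    fix z assume "z \<in> keys ?c"
    then have "- x + z \<in> E" using b(2) keys_single_skew_mult by blast
    then show "z \<in> (+) x ` E" by (intro image_eqI[of _ _ "- x + z"]) simp_all
  qed
  moreover have "card ((+) x ` E) = min_support B" using E by (simp add: card_image)
  ultimately have "?c = 0" using min_support_eq_0[of ?c B "(+) x ` E" "x + h"] E(1) h by blast
  then have "lookup ?c x = 0" by simp
  then show False using s(2) by (simp add: lookup_single_skew_mult b(3))
qed

text \<open>Surround \<open>a\<close> by homogeneous factors of degrees \<open>y\<close> and
  \<open>x\<close> in \<open>W\<close>, the left one beginning and the right one ending with
  \<open>k\<close>, so that the product is nonzero. By minimality its coefficient at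
  \<open>y + f + x\<close> is nonzero too, which makes this degree linked and puts \<open>f\<close>
  into \<open>W\<close>.\<close>

lemma support_subset:
  assumes prime: "G_prime D \<alpha>" and A: "skew_ideal A" and F: "finite F" "card F = min_support A"
    and k: "k \<in> coeffs A F" "k \<noteq> 0" and W: "add_subgroup W" "linked k k \<subseteq> W"
  shows "F \<subseteq> W"
proof
  fix f assume f: "f \<in> F"
  obtain a where a: "a \<in> A" "keys a \<subseteq> F" "k = lookup a 0" using k by (auto simp: coeffs_def)
  obtain x t where t: "t \<in> D x" "hm x (k * t) k \<noteq> 0" using G_prime_separation[OF prime k(2) k(2)] .
  define \<tau> where "\<tau> = hm x t k"
  have \<tau>: "\<tau> \<in> D x" unfolding \<tau>_def by (rule hm_mem_left[OF t(1)])
  have "k * \<tau> \<noteq> 0" using t by (simp add: \<tau>_def hm_mult_left)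
  then obtain t' where t': "t' \<in> D (- x)" "hm x (k * \<tau>) t' \<noteq> 0"
    using hm_nondegenerate[OF D_mult_left[OF \<tau>]] by blast
  then have "k * hm x \<tau> t' \<noteq> 0" using \<tau> by (simp add: hm_mult_left)
  from G_prime_separation[OF prime k(2) this]
  obtain y s where s: "s \<in> D y" "hm y (k * s) (k * hm x \<tau> t') \<noteq> 0" .
  have ks: "k * s \<in> D y" by (rule D_mult_left[OF s(1)])
  have kk: "hm y (hm y (k * s) k) (hm x \<tau> t') \<noteq> 0"
    using s(2) by (simp add: hm_mult_middle[OF ks])
  then have "hm y (k * s) k \<noteq> 0" by auto
  then have yx: "y \<in> W" "x \<in> W" using W(2) s(1) t linkedI by blast+
  have nz: "hm y (hm y (k * s) k) \<tau> \<noteq> 0"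
    using kk hm_assoc[OF hm_mem_left[OF ks] \<tau>, of k t'] by auto
  let ?b = "skew_mult \<alpha> (skew_mult \<alpha> (single y (k * s)) a) (single x \<tau>)"
  have b: "?b \<in> A"
    by (intro skew_idealD(3)[OF A skew_idealD(2)[OF A a(1) ks]] \<tau>)
  have look: "lookup ?b (y + e + x) = hm (y + e) (hm y (k * s) (lookup a e)) \<tau>" for e
    by (simp add: lookup_skew_mult_single lookup_single_skew_mult)
  have "?b \<noteq> 0" using nz look[of 0] a(3) by auto
  moreover have "keys ?b \<subseteq> (\<lambda>e. y + e + x) ` F"
  proof
    fix z assume "z \<in> keys ?b"
    then have "- y + (z - x) \<in> F"
      using a(2) keys_skew_mult_single keys_single_skew_mult by blast
    then show "z \<in> (\<lambda>e. y + e + x) ` F"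
      by (intro image_eqI[of _ _ "- y + (z - x)"]) simp_all
  qed
  moreover have "card ((\<lambda>e. y + e + x) ` F) = min_support A"
    using F(2) by (subst card_image) (auto simp: inj_on_def)
  ultimately have "lookup ?b (y + f + x) \<noteq> 0"
    using min_support_eq_0[of ?b A "(\<lambda>e. y + e + x) ` F" "y + f + x"] b F(1) f by blast
  moreover define u where "u = hm y s (lookup a f)"
  have u: "u \<in> D (y + f)" unfolding u_def by (rule hm_mem[OF s(1) skew_idealD(1)[OF A a(1)]])
  have "hm y (k * s) (lookup a f) = k * u" by (simp add: u_def hm_mult_left[OF s(1)])
  moreover have "hm (y + f) (k * u) \<tau> = hm (y + f + x) (k * hm (y + f) u t) k"
    using hm_assoc[OF D_mult_left[OF u] t(1)] by (simp add: \<tau>_def hm_mult_left[OF u])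
  ultimately have "hm (y + f + x) (k * hm (y + f) u t) k \<noteq> 0" by (simp add: look)
  then have "y + f + x \<in> W" using W(2) linkedI[OF hm_mem[OF u t(1)]] by blast
  then show "f \<in> W" using add_subgroup_cancel[OF W(1)] yx by metis
qed

text \<open>Inside the FC center of \<open>W\<close>, the parts of \<open>F\<close> and of the
  conjugate of \<open>E\<close> by \<open>x\<close> have a unique product. It has a second
  factorization through all of \<open>F\<close> and \<open>E\<close>; if \<open>g'\<close> were in
  the center, so would be \<open>h'\<close>, contradicting uniqueness.\<close>

lemma linked_conjugate:
  assumes tf: "torsion_free TYPE('g)" and prime: "G_prime D \<alpha>"
    and A: "skew_ideal A" and B: "skew_ideal B"
    and AB: "\<And>a b. a \<in> A \<Longrightarrow> b \<in> B \<Longrightarrow> skew_mult \<alpha> a b = 0"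
    and F: "finite F" "card F = min_support A" and E: "finite E" "card E = min_support B"
    and k: "k \<in> coeffs A F" "k \<in> coeffs B E" "k \<noteq> 0" and W: "add_subgroup W" "linked k k \<subseteq> W"
    and x: "x \<in> linked k k"
  obtains g g' h h' where "g \<in> F \<inter> fc_center W" "g' \<in> F - fc_center W" "h \<in> E" "h' \<in> E"
    "conjugate x (h' + - h) = - g' + g"
proof -
  have zero: "0 \<in> G" if kG: "k \<in> coeffs C G" for C :: "('g \<Rightarrow>\<^sub>0 'r) set" and G
    using kG k(3) by (auto simp: coeffs_def in_keys_iff)
  note fcW = add_subgroup_fc_center[OF W(1)]
  have xW: "x \<in> W" using x W(2) by blast
  let ?P = "F \<inter> fc_center W" and ?Q = "conjugate x ` (E \<inter> fc_center W)"
  have "0 \<in> ?P" "0 \<in> E \<inter> fc_center W" using zero k add_subgroupD(1)[OF fcW] by auto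
  then have ne: "?P \<noteq> {}" "?Q \<noteq> {}" by blast+
  have sub: "?P \<subseteq> fc_center W" "?Q \<subseteq> fc_center W" using conjugate_fc_center[OF W(1) _ xW] by auto
  have fin: "finite ?P" "finite ?Q" using F E by auto
  obtain g q where g: "g \<in> ?P" and q: "q \<in> ?Q"
    and uniq: "\<And>p' q'. p' \<in> ?P \<Longrightarrow> q' \<in> ?Q \<Longrightarrow> p' + q' = g + q \<Longrightarrow> p' = g \<and> q' = q"
    using unique_product[OF tf fcW fc_center_commute[OF tf W(1)] fin(1) ne(1) sub(1) fin(2) ne(2) sub(2)]
    by blast
  obtain h where h: "h \<in> E \<inter> fc_center W" "q = conjugate x h" using q by blast
  obtain g' h' where gh': "g' \<in> F" "h' \<in> E" "(g', h') \<noteq> (g, h)" and e: "g' + x + h' = g + x + h"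
    using linked_not_unique_product[OF A B AB F E k(1,2) x, of g h] g h by blast
  have e': "g' + conjugate x h' = g + conjugate x h"
    using e by (simp add: conjugate_def add.assoc[symmetric] add_diff_eq)
  then have h'g': "conjugate x h' = - g' + (g + conjugate x h)" by (metis minus_add_cancel)
  have "g' \<notin> fc_center W"
  proof
    assume "g' \<in> fc_center W"
    then have "conjugate x h' \<in> fc_center W"
      unfolding h'g' using g q h sub by (intro add_subgroupD(2,3)[OF fcW]) auto
    then have "h' \<in> fc_center W"
      using conjugate_fc_center[OF W(1) _ add_subgroupD(3)[OF W(1) xW], of "conjugate x h'"] by simp
    then have "g' = g \<and> conjugate x h' = q"
      using uniq \<open>g' \<in> fc_center W\<close> gh' e' h by blast
    then show False using gh'(3) h(2) injD[OF inj_conjugate, of x h' h] by simp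
  qed
  moreover have "conjugate x (h' + - h) = - g' + g"
    unfolding conjugate_add conjugate_minus h'g' by (simp only: add.assoc right_minus add_0_right)
  ultimately show thesis using that g h gh' by blast
qed

lemma ideal_product_nonzero:
  assumes tf: "torsion_free TYPE('g)" and prime: "G_prime D \<alpha>"
    and A: "skew_ideal A" "A \<noteq> {0}" and B: "skew_ideal B" "B \<noteq> {0}"
  shows "\<exists>a\<in>A. \<exists>b\<in>B. skew_mult \<alpha> a b \<noteq> 0"
proof (rule ccontr)
  assume "\<not> ?thesis"
  then have AB: "\<And>a b. a \<in> A \<Longrightarrow> b \<in> B \<Longrightarrow> skew_mult \<alpha> a b = 0" by blast
  obtain a where a: "a \<in> A" "lookup a 0 \<noteq> 0" "card (keys a) = min_support A"
    using exists_min_support[OF A] .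
  obtain b where b: "b \<in> B" "lookup b 0 \<noteq> 0" "card (keys b) = min_support B"
    using exists_min_support[OF B] .
  obtain x s where s: "s \<in> D x" "hm x (lookup a 0 * s) (lookup b 0) \<noteq> 0"
    using G_prime_separation[OF prime a(2) b(2)] .
  have as: "lookup a 0 * s \<in> D x" by (rule D_mult_left[OF s(1)])
  obtain t where t: "t \<in> D (- x)" "hm x (hm x (lookup a 0 * s) (lookup b 0)) t \<noteq> 0"
    using hm_nondegenerate[OF hm_mem_left[OF as] s(2)] .
  \<comment> \<open>At once a right multiple of the coefficient of \<open>a\<close> at 0 and the
    coefficient at 0 of \<open>b\<close> multiplied on both sides in degrees \<open>x\<close> and
    \<open>- x\<close>; the latter conjugates the support of \<open>b\<close> into
    \<open>E\<close>.\<close>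
  define k0 where "k0 = hm x (hm x (lookup a 0 * s) (lookup b 0)) t"
  define F where "F = keys a"
  define E where "E = conjugate x ` keys b"
  have F: "finite F" "card F = min_support A" using a by (simp_all add: F_def)
  have E: "finite E" "card E = min_support B"
    using b by (simp_all add: E_def card_image inj_on_subset[OF inj_conjugate])
  have "lookup a 0 \<in> coeffs A F" using a(1) unfolding coeffs_def F_def by blast
  then have kA: "k0 \<in> coeffs A F"
    using coeffs_mult[OF A(1)] s(1) by (simp add: k0_def hm_mult_left hm_mem_left)
  have kB: "k0 \<in> coeffs B E"
  proof -
    let ?c = "skew_mult \<alpha> (skew_mult \<alpha> (single x (lookup a 0 * s)) b) (single (- x) t)"
    have look: "lookup ?c z = hm (z + x) (hm x (lookup a 0 * s) (lookup b (- x + (z + x)))) t" for z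
      by (simp add: lookup_skew_mult_single lookup_single_skew_mult)
    have "?c \<in> B" by (intro skew_idealD(3)[OF B(1) skew_idealD(2)[OF B(1) b(1) as]] t)
    moreover have "keys ?c \<subseteq> E"
    proof
      fix z assume "z \<in> keys ?c"
      then have "- x + (z + x) \<in> keys b"
        unfolding in_keys_iff look by (metis hm_zero)
      moreover have "z = conjugate x (- x + (z + x))"
        by (simp add: conjugate_def add.assoc[symmetric])
      ultimately show "z \<in> E" unfolding E_def by blast
    qed
    moreover have "lookup ?c 0 = k0" unfolding look k0_def by simp
    ultimately show ?thesis unfolding coeffs_def by blast
  qed
  define S where "S = (\<lambda>k W. k \<noteq> 0 \<and> k \<in> coeffs A F \<and> k \<in> coeffs B E \<and> add_subgroup W \<and> linked k k \<subseteq> W)"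
  have S0: "S k0 UNIV" using kA kB t(2) by (simp add: S_def k0_def add_subgroup_UNIV)
  \<comment> \<open>An extremal choice: as many elements of \<open>F\<close> as possible have a
    finite class under \<open>W\<close>.\<close>
  have "\<exists>p. S (fst p) (snd p) \<and>
      (\<forall>q. S (fst q) (snd q) \<longrightarrow> card (F \<inter> fc_center (snd q)) \<le> card (F \<inter> fc_center (snd p)))"
  proof (rule Lattices_Big.ex_has_greatest_nat)
    show "S (fst (k0, UNIV)) (snd (k0, UNIV))" using S0 by simp
    show "\<forall>q. S (fst q) (snd q) \<longrightarrow> card (F \<inter> fc_center (snd q)) < Suc (card F)"
      using F(1) by (auto intro: card_mono simp: less_Suc_eq_le)
  qed
  then obtain k W where SkW: "S k W"
    and max: "\<And>k' W'. S k' W' \<Longrightarrow> card (F \<inter> fc_center W') \<le> card (F \<inter> fc_center W)"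
    by force
  have k: "k \<noteq> 0" "k \<in> coeffs A F" "k \<in> coeffs B E" and W: "add_subgroup W" "linked k k \<subseteq> W"
    using SkW by (simp_all add: S_def)
  define P where "P = (\<lambda>\<kappa>. \<kappa> \<noteq> 0 \<and> (\<exists>r. \<kappa> = k * r))"
  define U where "U = (\<lambda>(g, g'). - g' + g) ` ((F \<inter> fc_center W) \<times> (F - fc_center W))"
  define V where "V = (\<lambda>(h', h). h' + - h) ` (E \<times> E)"
  obtain \<kappa> W' u where P\<kappa>: "P \<kappa>" and W': "add_subgroup W'" "linked \<kappa> \<kappa> \<subseteq> W'"
    and u: "u \<in> U" "finite ((\<lambda>w. conjugate w u) ` W')"
  \<comment> \<open>The right entry stays \<open>k\<close> in the sets to be covered, and only the
    left one passes to right multiples \<kappa> of \<open>k\<close>.\<close>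
  proof (rule conjugation_stabilizer[of U V P "\<lambda>\<kappa>. linked \<kappa> k" "\<lambda>\<kappa>. linked \<kappa> \<kappa>" k])
    show "finite U" "finite V" using F E by (simp_all add: U_def V_def)
    show "linked \<kappa> k \<noteq> {}" if P: "P \<kappa>" for \<kappa>
    proof -
      have "\<kappa> \<noteq> 0" using P by (simp add: P_def)
      from G_prime_separation[OF prime this k(1)]
      obtain z \<sigma> where "\<sigma> \<in> D z" "hm z (\<kappa> * \<sigma>) k \<noteq> 0" .
      then show ?thesis using linkedI by blast
    qed
    obtain e where "k * e = k" using right_unit[OF D_zero] .
    then show "P k" using k(1) unfolding P_def by metis
    show "\<exists>v\<in>V. conjugate x v \<in> U" if x: "x \<in> linked k k" for x
    proof -
      obtain g g' h h' where "g \<in> F \<inter> fc_center W" "g' \<in> F - fc_center W" "h \<in> E" "h' \<in> E"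
        "conjugate x (h' + - h) = - g' + g"
        using linked_conjugate[OF tf prime A(1) B(1) AB F E k(2,3,1) W x] .
      then show ?thesis unfolding U_def V_def by (intro bexI[of _ "h' + - h"]) force+
    qed
    show "\<exists>\<kappa>'. P \<kappa>' \<and> linked \<kappa>' k \<subseteq> linked \<kappa> k \<inter> (+) y ` linked \<kappa> k"
      if P: "P \<kappa>" and y: "y \<in> linked \<kappa> \<kappa>" for \<kappa> y
    proof -
      obtain s where s: "s \<in> D y" "hm y (\<kappa> * s) \<kappa> \<noteq> 0" using y by (auto simp: linked_def)
      have \<kappa>s: "\<kappa> * s \<in> D y" by (rule D_mult_left[OF s(1)])
      obtain t where t: "t \<in> D (- y)" "hm y (hm y (\<kappa> * s) \<kappa>) t \<noteq> 0"
        using hm_nondegenerate[OF hm_mem_left[OF \<kappa>s] s(2)] .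
      \<comment> \<open>\<open>\<kappa> * \<rho>\<close> is a right multiple of \<kappa>, which
        keeps \<open>z\<close> in \<open>linked \<kappa> k\<close>; it also equals (\<kappa> s
        \<delta>_y) \<kappa> (t \<delta>_{-y}), whose middle \<kappa> gives the same for
        \<open>- y + z\<close>.\<close>
      define \<rho> where "\<rho> = hm y (hm y s \<kappa>) t"
      have \<kappa>\<rho>: "\<kappa> * \<rho> = hm y (hm y (\<kappa> * s) \<kappa>) t"
        using s(1) by (simp add: \<rho>_def hm_mult_left hm_mem_left)
      have "P (\<kappa> * \<rho>)" using P t(2) unfolding P_def \<kappa>\<rho>[symmetric] by (auto simp: mult.assoc)
      moreover have "z \<in> linked \<kappa> k \<inter> (+) y ` linked \<kappa> k" if z: "z \<in> linked (\<kappa> * \<rho>) k" for z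
      proof -
        obtain \<sigma> where \<sigma>: "\<sigma> \<in> D z" "hm z (\<kappa> * \<rho> * \<sigma>) k \<noteq> 0" using z by (auto simp: linked_def)
        have "z \<in> linked \<kappa> k"
          using \<sigma> by (intro linkedI[of "\<rho> * \<sigma>"]) (simp_all add: mult.assoc D_mult_left)
        moreover have "- y + z \<in> linked \<kappa> k"
        proof (rule linkedI)
          show \<sigma>': "hm (- y) t \<sigma> \<in> D (- y + z)" by (rule hm_mem[OF t(1) \<sigma>(1)])
          have "\<kappa> * \<rho> * \<sigma> = hm y (hm y (\<kappa> * s) \<kappa>) (hm (- y) t \<sigma>)"
            using hm_assoc[OF hm_mem_left[OF \<kappa>s] t(1), of \<kappa> \<sigma>] by (simp add: \<kappa>\<rho>)
          also have "\<dots> = hm y (\<kappa> * s) (\<kappa> * hm (- y) t \<sigma>)" by (rule hm_mult_middle[OF \<kappa>s])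
          finally have "hm z (\<kappa> * \<rho> * \<sigma>) k = hm y (\<kappa> * s) (hm (- y + z) (\<kappa> * hm (- y) t \<sigma>) k)"
            using hm_assoc[OF \<kappa>s D_mult_left[OF \<sigma>', of \<kappa>], of k] by (simp add: add.assoc[symmetric])
          then show "hm (- y + z) (\<kappa> * hm (- y) t \<sigma>) k \<noteq> 0" using \<sigma>(2) by auto
        qed
        ultimately show ?thesis by (auto intro: image_eqI[of _ _ "- y + z"])
      qed
      ultimately show ?thesis by blast
    qed
  qed
  obtain r where \<kappa>: "\<kappa> \<noteq> 0" "\<kappa> = k * r" using P\<kappa> by (auto simp: P_def)
  have "linked \<kappa> \<kappa> \<subseteq> linked k k"
  proof
    fix z assume "z \<in> linked \<kappa> \<kappa>"
    then obtain \<sigma> where \<sigma>: "\<sigma> \<in> D z" "hm z (k * r * \<sigma>) (k * r) \<noteq> 0" by (auto simp: linked_def \<kappa>)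
    then have "hm z (hm z (k * (r * \<sigma>)) k) r \<noteq> 0"
      by (simp add: hm_mult_middle D_mult_left mult.assoc)
    then have "hm z (k * (r * \<sigma>)) k \<noteq> 0" by auto
    then show "z \<in> linked k k" by (rule linkedI[OF D_mult_left[OF \<sigma>(1)]])
  qed
  then have lWW: "linked \<kappa> \<kappa> \<subseteq> W \<inter> W'" using W W' by blast
  have sub: "add_subgroup (W \<inter> W')" using W W' by (intro add_subgroup_Int)
  have \<kappa>A: "\<kappa> \<in> coeffs A F" "\<kappa> \<in> coeffs B E" unfolding \<kappa> using coeffs_mult A B k by auto
  have S': "S \<kappa> (W \<inter> W')" using \<kappa>A \<kappa>(1) sub lWW by (simp add: S_def)
  have FW: "F \<subseteq> W \<inter> W'" by (rule support_subset[OF prime A(1) F \<kappa>A(1) \<kappa>(1) sub lWW])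
  have fc_mono: "g \<in> fc_center (W \<inter> W')" if g: "g \<in> F" "g \<in> fc_center W" for g
    using g FW by (auto simp: fc_center_def intro: finite_subset[OF image_mono])
  obtain g g' where g: "g \<in> F" "g \<in> fc_center W" and g': "g' \<in> F" "g' \<notin> fc_center W" and ug: "u = - g' + g"
    using u(1) by (auto simp: U_def)
  have "u \<in> W \<inter> W'"
    unfolding ug using g(1) g'(1) FW by (intro add_subgroupD(2,3)[OF sub]) auto
  moreover have "finite ((\<lambda>w. conjugate w u) ` (W \<inter> W'))"
    by (rule finite_subset[OF image_mono[OF Int_lower2] u(2)])
  ultimately have "u \<in> fc_center (W \<inter> W')" unfolding fc_center_def by blast
  \<comment> \<open>As \<open>u = - g' + g\<close>, this element is \<open>g'\<close>; its class was
    infinite under \<open>W\<close>, so the extremal choice is contradicted.\<close>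
  then have "g + - u \<in> fc_center (W \<inter> W')"
    by (intro add_subgroupD(2,3)[OF add_subgroup_fc_center[OF sub]] fc_mono[OF g])
  then have "g' \<in> fc_center (W \<inter> W')" by (simp add: ug diff_conv_add_uminus minus_add del: add_uminus_conv_diff)
  then have "F \<inter> fc_center W \<subset> F \<inter> fc_center (W \<inter> W')" using fc_mono g' by blast
  then have "card (F \<inter> fc_center W) < card (F \<inter> fc_center (W \<inter> W'))" using F(1) by (intro psubset_card_mono) auto
  then show False using max[OF S'] by simp
qed

section \<open>The two implications of the equivalence\<close>

lemma invariant_ideal_hm:
  assumes I: "ring_ideal I" "G_invariant D \<alpha> I"
  shows "r \<in> D g \<Longrightarrow> r \<in> I \<Longrightarrow> hm g r r' \<in> I" "r \<in> D g \<Longrightarrow> r' \<in> I \<Longrightarrow> hm g r r' \<in> I"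
proof -
  have inv: "\<alpha> g u \<in> I" if "u \<in> I" "u \<in> D (- g)" for g u
    using I(2)[unfolded G_invariant_def ideal_prod_D[OF I(1)]] that by blast
  show "hm g r r' \<in> I" if "r \<in> D g" "r \<in> I"
    unfolding hm_def using that inv[of r "- g"]
    by (intro inv ring_idealD(5)[OF I(1)] D_mult_right alpha_minus_mem) simp_all
  show "hm g r r' \<in> I" if "r \<in> D g" "r' \<in> I"
    unfolding hm_def using that
    by (intro inv ring_idealD(4)[OF I(1)] D_mult_right alpha_minus_mem)
qed

text \<open>Elements with all coefficients in an invariant ideal \<open>I\<close> form an ideal
  \<open>ext I\<close>. Invariance carries \<open>I \<odot> J = {0}\<close> over to the extensions,
  and \<open>I\<close> is recovered from \<open>ext I\<close> in degree 0.\<close>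

lemma G_prime_if_prime:
  assumes prime: "prime_ring (skew_carrier D) (skew_mult \<alpha>)"
  shows "G_prime D \<alpha>"
  unfolding G_prime_def
proof (intro allI impI)
  fix I J assume I: "ring_ideal I" "G_invariant D \<alpha> I" and J: "ring_ideal J" "G_invariant D \<alpha> J"
    and IJ: "I \<odot> J = {0}"
  define ext where "ext = (\<lambda>I. {x \<in> skew_carrier D. \<forall>g. lookup x g \<in> I})"
  have ideal: "skew_ideal (ext I)" if I: "ring_ideal I" "G_invariant D \<alpha> I" for I
    unfolding is_ideal_def
  proof (intro conjI ballI)
    show "ext I \<subseteq> skew_carrier D" "0 \<in> ext I"
      using zero_D ring_idealD[OF I(1)] by (auto simp: ext_def skew_carrier_def)
    fix x assume x: "x \<in> ext I"
    then show "- x \<in> ext I" 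
      using ring_idealD[OF I(1)] D_minus by (auto simp: ext_def skew_carrier_def)
    show "x + y \<in> ext I" if "y \<in> ext I" for y
      using x that ring_idealD[OF I(1)] D_add by (auto simp: ext_def skew_carrier_def lookup_add)
    fix t assume t: "t \<in> skew_carrier D"
    have D: "lookup x g \<in> D g" "lookup x g \<in> I" "lookup t g \<in> D g" for g
      using x t by (auto simp: ext_def skew_carrier_def)
    show "skew_mult \<alpha> t x \<in> ext I" "skew_mult \<alpha> x t \<in> ext I"
      using x t skew_mult_closed D invariant_ideal_hm[OF I]
      by (auto simp: ext_def lookup_skew_mult intro!: ring_ideal_sum[OF I(1)])
  qed
  have zero: "u * v = 0" if "u \<in> I" "v \<in> J" for u v
    using IJ that ideal_prod_mem[of u I v J "(*)"] by auto
  have "skew_mult \<alpha> x y = 0" if x: "x \<in> ext I" and y: "y \<in> ext J" for x y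
  proof -
    have "hm g (lookup x g) (lookup y h) = 0" for g h
    proof -
      have "lookup x g \<in> I" "lookup x g \<in> D g" "lookup y h \<in> J" using x y by (auto simp: ext_def skew_carrier_def)
      moreover from this have "\<alpha> (- g) (lookup x g) \<in> I"
        using I(2)[unfolded G_invariant_def ideal_prod_D[OF I(1)], THEN spec, of "- g"] by auto
      ultimately show ?thesis using zero by (simp add: hm_def alpha_zero)
    qed
    then show ?thesis by (intro poly_mapping_eqI) (simp add: lookup_skew_mult)
  qed
  moreover have "ext I \<noteq> {}" "ext J \<noteq> {}"
    using ideal[OF I] ideal[OF J] unfolding is_ideal_def by blast+
  ultimately have "finite_sums_of_products (skew_mult \<alpha>) (ext I) (ext J) = {0}"
    by (simp add: ideal_prod_eq_zero_iff)
  then have "ext I = {0} \<or> ext J = {0}"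
    using prime ideal[OF I] ideal[OF J] unfolding prime_ring_def by blast
  moreover have "I = {0}" if I: "ring_ideal I" "ext I = {0}" for I
  proof -
    have "single 0 r \<in> ext I" if "r \<in> I" for r
      using that single_skew_carrier[OF D_zero] ring_idealD(1)[OF I(1)]
      by (auto simp: ext_def lookup_single when_def)
    then have "single (0::'g) r = 0" if "r \<in> I" for r
      using that I(2) by blast
    then have "r = 0" if "r \<in> I" for r
      using that by (metis lookup_single_eq lookup_zero)
    then show ?thesis using ring_idealD(1)[OF I(1)] by blast
  qed
  ultimately show "I = {0} \<or> J = {0}" using I J by blast
qed

lemma prime_if_G_prime:
  assumes tf: "torsion_free TYPE('g)" and nonzero: "(UNIV :: 'r set) \<noteq> {0}" and prime: "G_prime D \<alpha>"
  shows "prime_ring (skew_carrier D) (skew_mult \<alpha>)"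
  unfolding prime_ring_def
proof (intro conjI allI impI)
  obtain r :: 'r where "r \<noteq> 0" using nonzero by auto
  then have "single (0::'g) r \<noteq> 0" by (metis lookup_single_eq lookup_zero)
  then show "{0} \<noteq> skew_carrier D" using single_skew_carrier[OF D_zero] by blast
  fix A B assume A: "skew_ideal A" and B: "skew_ideal B"
    and "finite_sums_of_products (skew_mult \<alpha>) A B = {0}"
  moreover have "A \<noteq> {}" "B \<noteq> {}" using A B by (auto simp: is_ideal_def)
  ultimately have "\<forall>a\<in>A. \<forall>b\<in>B. skew_mult \<alpha> a b = 0" using ideal_prod_eq_zero_iff by metis
  then show "A = {0} \<or> B = {0}" using ideal_product_nonzero[OF tf prime A _ B] by blast
qed

end

theorem theorem13p5:
  fixes D :: "'g::group_add \<Rightarrow> 'r::ring set"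
    and \<alpha> :: "'g \<Rightarrow> 'r \<Rightarrow> 'r"
  assumes torsion_free: "\<And>(g::'g) n. n > 0 \<Longrightarrow> sum_list (replicate n g) = 0 \<Longrightarrow> g = 0"
    and nonzero: "(UNIV :: 'r set) \<noteq> {0}"
    and "partial_action D \<alpha>"
  shows "prime_ring (skew_carrier D) (skew_mult \<alpha>) \<longleftrightarrow> G_prime D \<alpha>"
proof -
  interpret partial_action D \<alpha> by fact
  have "torsion_free TYPE('g)" using torsion_free by (auto simp: torsion_free_def)
  then show ?thesis using G_prime_if_prime prime_if_G_prime nonzero by blast
qed

end
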